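(* Let $\phi$ be the function $$\phi(s)=\frac{\prod_{j=1}^{m}\Gamma^{B_j}(b_j-\beta_j s)\,\prod_{j=1}^{n}\Gamma^{A_j}(1-a_j+\alpha_j s)}{\prod_{j=m+1}^{q}\Gamma^{B_j}(1-b_j+\beta_j s)\,\prod_{j=n+1}^{p}\Gamma^{A_j}(a_j-\alpha_j s)}$$ with parameters as described in the context. Let $L$ be a loop beginning and ending at $-\infty$ and encircling all the singularities of $\Gamma^{A_j}(1-a_j+\alpha_j s)$, $j=1,\ldots,n$, once in the anti-clockwise direction, but none of the singularities of $\Gamma^{B_j}(b_j-\beta_j s)$, $j=1,\ldots,m$. Put $$\mu=\sum_{j=1}^{q}B_j\beta_j-\sum_{j=1}^{p}A_j\alpha_j,\qquad \nu=\prod_{j=1}^{q}\beta_j^{B_j\beta_j}\bigg/\prod_{j=1}^{p}\alpha_j^{A_j\alpha_j}.$$ Let $z\ne 0$. Then the integral $$\frac{1}{2\pi i}\int_L\phi(s)\,z^s\,ds$$ converges if $p\ge 1$ and either $\mu<0$, or $\mu=0$ and $|z|>\nu$.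
   Context: The integral in question defines the $I$-function $I^{m\,n}_{p\,q}\left[z\,\middle|\,\begin{matrix}(a_1,\alpha_1,A_1),\ldots,(a_p,\alpha_p,A_p)\\(b_1,\beta_1,B_1),\ldots,(b_q,\beta_q,B_q)\end{matrix}\right]=(2\pi i)^{-1}\int_L\phi(s)z^s\,ds$, a generalization of Fox's $H$-function. Standing assumptions: $z\ne 0$ is complex; $i=\sqrt{-1}$; $m,n,p,q$ are integers with $0\le m\le q$ and $0\le n\le p$; an empty product is interpreted as $1$ (and an empty sum as $0$); $\alpha_j,A_j$ ($j=1,\ldots,p$) and $\beta_j,B_j$ ($j=1,\ldots,q$) are positive real numbers, not necessarily integers; $a_j$ ($j=1,\ldots,p$) and $b_j$ ($j=1,\ldots,q$) are complex numbers such that no singularity of $\Gamma^{B_j}(b_j-\beta_j s)$, $j=1,\ldots,m$, coincides with any singularity of $\Gamma^{A_j}(1-a_j+\alpha_j s)$, $j=1,\ldots,n$. Here $\Gamma^{B}(w)$ denotes the power $(\Gamma(w))^{B}$. When the exponent is not an integer, the poles of the gamma functions in the numerator become branch points; the branch cuts are chosen so that the path of integration $L$ does not meet them, so that $\phi$ is given by a continuous branch along $L$. The power $z^s$ means $\exp\{s(\ln|z|+i\arg z)\}$. *)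

theory Defs
  imports "HOL-Complex_Analysis.Complex_Analysis"
begin

text \<open>All values of the multivalued power \<open>w\<^sup>c\<close> for real \<open>c\<close>. At \<open>w = 0\<close> the only
  value is \<open>0\<close>, the limit for \<open>c > 0\<close>.\<close>
definition power_values :: "complex \<Rightarrow> real \<Rightarrow> complex set" where
  "power_values w c = (if w = 0 then {0} else {exp (of_real c * l) | l. exp l = w})"

text \<open>At a pole \<open>Gamma\<close> is \<open>0\<close> in the library. For a factor of the denominator the quotient
  is then \<open>0\<close> (division by zero), which is the correct limit of the reciprocal of the power;
  poles of the factors of the numerator have to be excluded separately.\<close>
definition I_integrand_values ::
  "nat \<Rightarrow> nat \<Rightarrow> nat \<Rightarrow> nat \<Rightarrow> (nat \<Rightarrow> complex) \<Rightarrow> (nat \<Rightarrow> real) \<Rightarrow> (nat \<Rightarrow> real) \<Rightarrow>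
   (nat \<Rightarrow> complex) \<Rightarrow> (nat \<Rightarrow> real) \<Rightarrow> (nat \<Rightarrow> real) \<Rightarrow> complex \<Rightarrow> complex set" where
  "I_integrand_values m n p q a \<alpha> A b \<beta> B s =
     {((\<Prod>j=1..m. U j) * (\<Prod>j=1..n. V j)) / ((\<Prod>j=m+1..q. W j) * (\<Prod>j=n+1..p. X j)) | U V W X.
        (\<forall>j\<in>{1..m}. U j \<in> power_values (Gamma (b j - of_real (\<beta> j) * s)) (B j)) \<and>
        (\<forall>j\<in>{1..n}. V j \<in> power_values (Gamma (1 - a j + of_real (\<alpha> j) * s)) (A j)) \<and>
        (\<forall>j\<in>{m+1..q}. W j \<in> power_values (Gamma (1 - b j + of_real (\<beta> j) * s)) (B j)) \<and>
        (\<forall>j\<in>{n+1..p}. X j \<in> power_values (Gamma (a j - of_real (\<alpha> j) * s)) (A j))}"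

text \<open>Instead of fixing branch cuts, the integrand on the set \<open>S\<close> (the contour) is any continuous
  choice among the values of the multivalued expression.\<close>
definition I_integrand_branch_on ::
  "complex set \<Rightarrow> nat \<Rightarrow> nat \<Rightarrow> nat \<Rightarrow> nat \<Rightarrow> (nat \<Rightarrow> complex) \<Rightarrow> (nat \<Rightarrow> real) \<Rightarrow> (nat \<Rightarrow> real) \<Rightarrow>
   (nat \<Rightarrow> complex) \<Rightarrow> (nat \<Rightarrow> real) \<Rightarrow> (nat \<Rightarrow> real) \<Rightarrow> (complex \<Rightarrow> complex) \<Rightarrow> bool" where
  "I_integrand_branch_on S m n p q a \<alpha> A b \<beta> B \<phi> \<longleftrightarrow>
     continuous_on S \<phi> \<and> (\<forall>s\<in>S. \<phi> s \<in> I_integrand_values m n p q a \<alpha> A b \<beta> B s)"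

text \<open>The exponents are positive, so the singularities (poles or branch points) of a power of
  \<open>Gamma\<close> are exactly the poles of \<open>Gamma\<close>.\<close>
definition left_singularities :: "nat \<Rightarrow> (nat \<Rightarrow> complex) \<Rightarrow> (nat \<Rightarrow> real) \<Rightarrow> complex set" where
  "left_singularities n a \<alpha> = {s. \<exists>j\<in>{1..n}. 1 - a j + of_real (\<alpha> j) * s \<in> \<int>\<^sub>\<le>\<^sub>0}"

definition right_singularities :: "nat \<Rightarrow> (nat \<Rightarrow> complex) \<Rightarrow> (nat \<Rightarrow> real) \<Rightarrow> complex set" where
  "right_singularities m b \<beta> = {s. \<exists>j\<in>{1..m}. b j - of_real (\<beta> j) * s \<in> \<int>\<^sub>\<le>\<^sub>0}"

text \<open>A piecewise smooth curve, parametrized by the whole real line, that begins and ends at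
  \<open>-\<infinity>\<close>: it lies in a horizontal strip, its real part tends to \<open>-\<infinity>\<close> at both ends, and
  far out each end runs to the left without oscillation (displacement is bounded by a multiple of
  the horizontal progress; for horizontal half-lines \<open>K = 1\<close> works).\<close>
definition left_loop :: "(real \<Rightarrow> complex) \<Rightarrow> bool" where
  "left_loop \<gamma> \<longleftrightarrow>
     (\<forall>u v. valid_path (\<gamma> \<circ> linepath u v)) \<and>
     filterlim (\<lambda>t. Re (\<gamma> t)) at_bot at_bot \<and>
     filterlim (\<lambda>t. Re (\<gamma> t)) at_bot at_top \<and>
     bounded (range (\<lambda>t. Im (\<gamma> t))) \<and>
     (\<exists>T K. \<forall>s t. T \<le> s \<and> s \<le> t \<longrightarrow>
        dist (\<gamma> s) (\<gamma> t) \<le> K * (Re (\<gamma> s) - Re (\<gamma> t)) \<and>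
        dist (\<gamma> (- s)) (\<gamma> (- t)) \<le> K * (Re (\<gamma> (- s)) - Re (\<gamma> (- t))))"

text \<open>The winding number of such a loop is that of a long finite arc closed up by a segment. For
  a fixed point \<open>w\<close> off the loop it does not depend on \<open>T\<close> once \<open>T\<close> is large, since
  the segment then lies to the left of \<open>w\<close>.\<close>
definition closed_arc :: "(real \<Rightarrow> complex) \<Rightarrow> real \<Rightarrow> real \<Rightarrow> complex" where
  "closed_arc \<gamma> T = (\<gamma> \<circ> linepath (- T) T) +++ linepath (\<gamma> T) (\<gamma> (- T))"

definition loop_winds :: "(real \<Rightarrow> complex) \<Rightarrow> complex \<Rightarrow> int \<Rightarrow> bool" where
  "loop_winds \<gamma> w k \<longleftrightarrow> (\<forall>\<^sub>F T in at_top. winding_number (closed_arc \<gamma> T) w = of_int k)"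

text \<open>The loop keeps a positive distance from the singularities, so that it does not approach them
  asymptotically either.\<close>
definition loop_separates :: "(real \<Rightarrow> complex) \<Rightarrow> complex set \<Rightarrow> complex set \<Rightarrow> bool" where
  "loop_separates \<gamma> P Q \<longleftrightarrow>
     (\<exists>\<delta>>0. \<forall>t. \<forall>w\<in>P \<union> Q. \<delta> \<le> dist (\<gamma> t) w) \<and>
     (\<forall>w\<in>P. loop_winds \<gamma> w 1) \<and> (\<forall>w\<in>Q. loop_winds \<gamma> w 0)"

definition I_mu ::
  "nat \<Rightarrow> nat \<Rightarrow> (nat \<Rightarrow> real) \<Rightarrow> (nat \<Rightarrow> real) \<Rightarrow> (nat \<Rightarrow> real) \<Rightarrow> (nat \<Rightarrow> real) \<Rightarrow> real" where
  "I_mu p q \<alpha> A \<beta> B = (\<Sum>j=1..q. B j * \<beta> j) - (\<Sum>j=1..p. A j * \<alpha> j)"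

definition I_nu ::
  "nat \<Rightarrow> nat \<Rightarrow> (nat \<Rightarrow> real) \<Rightarrow> (nat \<Rightarrow> real) \<Rightarrow> (nat \<Rightarrow> real) \<Rightarrow> (nat \<Rightarrow> real) \<Rightarrow> real" where
  "I_nu p q \<alpha> A \<beta> B =
     (\<Prod>j=1..q. \<beta> j powr (B j * \<beta> j)) / (\<Prod>j=1..p. \<alpha> j powr (A j * \<alpha> j))"

text \<open>Improper contour integral: the two ends of the finite arc tend to \<open>-\<infinity>\<close>
  independently.\<close>
definition has_loop_integral ::
  "(complex \<Rightarrow> complex) \<Rightarrow> complex \<Rightarrow> (real \<Rightarrow> complex) \<Rightarrow> bool" where
  "has_loop_integral f I \<gamma> \<longleftrightarrow>
     (\<forall>u v. u \<le> v \<longrightarrow> f contour_integrable_on (\<gamma> \<circ> linepath u v)) \<and>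
     ((\<lambda>(u, v). contour_integral (\<gamma> \<circ> linepath u v) f) \<longlongrightarrow> I) (at_bot \<times>\<^sub>F at_top)"

end

theory Submission
  imports Defs "HOL-Real_Asymp.Real_Asymp"
begin

text \<open>
  Convergence at the ends: for \<open>s = - x + i y\<close> with \<open>y\<close> bounded and \<open>x \<rightarrow> \<infinity>\<close>, the reflection formula
  turns every factor into a power of some \<open>Gamma (c + \<beta> x)\<close> up to bounded factors, and Stirling's formula gives
  \<open>ln \<bar>\<phi>(s) z\<^sup>s\<bar> \<le> \<mu> x ln x + (ln \<nu> - \<mu> - ln \<bar>z\<bar>) x + o(x)\<close>. So the integrand decays exponentially in
  \<open>x\<close>, and \<open>\<bar>d\<gamma>\<bar> \<le> K \<bar>d(Re \<gamma>)\<bar>\<close> near the ends.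

  Existence on finite arcs is not automatic, since a \<^const>\<open>valid_path\<close> may have infinite length. But near each of
  its points the integrand has the form \<open>\<omega> (s - s0)\<^sup>c h(s)\<close> with \<open>h\<close> holomorphic, \<open>c \<ge> 0\<close> and \<open>\<omega>\<close> from a
  countable set. By continuity \<open>\<omega>\<close> is constant as long as the path avoids \<open>s0\<close>, and this yields local
  primitives along the path.
\<close>

section \<open>Contour integrals along left loops\<close>

text \<open>Which branch \<phi> takes is unknown, and it may change where the loop meets a pole of a
  denominator Gamma factor, that is, a zero of the integrand. All expansions and estimates are
  therefore made for the whole set of values at once: products of factors become products of sets,
  and \<open>power_germ\<close> and \<open>growth_le\<close> are both stable under them. Continuity
  of \<phi> enters only when local primitives are built. The exponent c of a germ is never negative,
  because poles of the numerator stay off the loop and zeros come from reciprocal Gamma factors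
  alone. Poles of the numerator may lie in the strip arbitrarily far to the left, so the decay
  cannot hold throughout the strip. The uniform distance \<delta> from them bounds the sine in the
  reflection formula from below. Existence on finite arcs rests on the gauge integral, which
  integrates every derivative of a continuous function, with finitely many exceptional points, even
  when it is not absolutely integrable.\<close>

lemma has_vector_derivative_iff_quotient:
  fixes f :: "real \<Rightarrow> 'a::real_normed_vector"
  shows "(f has_vector_derivative D) (at x within S) \<longleftrightarrow>
           ((\<lambda>y. (f y - f x) /\<^sub>R (y - x)) \<longlongrightarrow> D) (at x within S)"
proof -
  have "norm (f y - f x - (y - x) *\<^sub>R D) / norm (y - x) = norm ((f y - f x) /\<^sub>R (y - x) - D)" if "y \<noteq> x" for y
  proof -
    have "(f y - f x) /\<^sub>R (y - x) - D = (f y - f x - (y - x) *\<^sub>R D) /\<^sub>R (y - x)"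
      using that by (simp add: scaleR_diff_right)
    then show ?thesis
      by (simp add: divide_inverse mult.commute)
  qed
  then have "((\<lambda>y. norm (f y - f x - (y - x) *\<^sub>R D) / norm (y - x)) \<longlongrightarrow> 0) (at x within S) \<longleftrightarrow>
             ((\<lambda>y. norm ((f y - f x) /\<^sub>R (y - x) - D)) \<longlongrightarrow> 0) (at x within S)"
    by (intro Lim_cong_within) auto
  then show ?thesis
    by (simp add: has_vector_derivative_def has_derivative_iff_norm bounded_linear_scaleR_left
        tendsto_norm_zero_iff LIM_zero_iff)
qed

text \<open>Dividing \<open>mono\<close> by the parameter increment and passing to the limit gives
  |g| \<le> -K Re g wherever \<gamma> has a derivative. The integrand is then dominated by -K
  exp(\<epsilon> Re \<gamma>) Re g, which has the primitive -(K/\<epsilon>) exp(\<epsilon> Re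
  \<gamma>).\<close>

lemma integral_along_monotone_curve_bound:
  fixes \<gamma> :: "real \<Rightarrow> complex" and g f :: "real \<Rightarrow> complex" and K \<epsilon> T :: real
  assumes mono: "\<And>s t. T \<le> s \<Longrightarrow> s \<le> t \<Longrightarrow> dist (\<gamma> s) (\<gamma> t) \<le> K * (Re (\<gamma> s) - Re (\<gamma> t))"
    and bound: "\<And>t. T \<le> t \<Longrightarrow> norm (f t) \<le> exp (\<epsilon> * Re (\<gamma> t))"
    and \<epsilon>: "\<epsilon> > 0"
    and cont: "continuous_on {u..v} \<gamma>"
    and S: "finite S" "\<And>t. t \<in> {u<..<v} - S \<Longrightarrow> (\<gamma> has_vector_derivative g t) (at t)"
    and int: "(\<lambda>t. f t * g t) integrable_on {u..v}"
    and uv: "T \<le> u" "u \<le> v"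
  shows "norm (integral {u..v} (\<lambda>t. f t * g t)) \<le> K / \<epsilon> * (exp (\<epsilon> * Re (\<gamma> u)) - exp (\<epsilon> * Re (\<gamma> v)))"
proof -
  define S' where "S' = insert u (insert v S)"
  have derivative_bound: "norm (g t) \<le> K * (- Re (g t))" if t: "t \<in> {u<..<v} - S" for t
  proof -
    have lim: "((\<lambda>y. (\<gamma> y - \<gamma> t) /\<^sub>R (y - t)) \<longlongrightarrow> g t) (at_right t)"
      using has_vector_derivative_at_within[OF S(2)[OF t]]
      by (simp add: has_vector_derivative_iff_quotient)
    have ev: "\<forall>\<^sub>F y in at_right t. norm ((\<gamma> y - \<gamma> t) /\<^sub>R (y - t)) \<le> K * (- Re ((\<gamma> y - \<gamma> t) /\<^sub>R (y - t)))"
      using eventually_at_right_less[of t]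
    proof eventually_elim
      case (elim y)
      have "norm ((\<gamma> y - \<gamma> t) /\<^sub>R (y - t)) = dist (\<gamma> t) (\<gamma> y) / (y - t)"
        using elim by (simp add: dist_norm norm_minus_commute divide_inverse mult.commute)
      also have "\<dots> \<le> K * (Re (\<gamma> t) - Re (\<gamma> y)) / (y - t)"
        using elim t uv by (intro divide_right_mono mono) auto
      also have "\<dots> = K * (- Re ((\<gamma> y - \<gamma> t) /\<^sub>R (y - t)))"
        by (simp add: divide_inverse algebra_simps)
      finally show ?case .
    qed
    show ?thesis
      by (rule tendsto_le[OF _ tendsto_mult[OF tendsto_const tendsto_minus[OF tendsto_Re[OF lim]]]
            tendsto_norm[OF lim] ev]) simp
  qed
  \<comment> \<open>Both integrands are set to 0 at the two ends and at the finitely many points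
    where the derivative may be missing, so that the comparison holds on the whole interval.\<close>
  define G where "G t = (if t \<in> S' then 0 else exp (\<epsilon> * Re (\<gamma> t)) * (K * (- Re (g t))))" for t
  define f' where "f' t = (if t \<in> S' then 0 else f t * g t)" for t
  have fin: "finite S'"
    using S(1) by (simp add: S'_def)
  have G: "(G has_integral (- (K / \<epsilon>) * exp (\<epsilon> * Re (\<gamma> v)) - (- (K / \<epsilon>) * exp (\<epsilon> * Re (\<gamma> u))))) {u..v}"
  proof (rule fundamental_theorem_of_calculus_interior_strong[OF fin uv(2)])
    fix t assume t: "t \<in> {u<..<v} - S'"
    then have "(\<gamma> has_vector_derivative g t) (at t)"
      using S(2) by (auto simp: S'_def)
    then have "((\<lambda>t. Re (\<gamma> t)) has_field_derivative Re (g t)) (at t)"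
      by (simp add: has_real_derivative_iff_has_vector_derivative bounded_linear.has_vector_derivative[OF bounded_linear_Re])
    then have "((\<lambda>t. - (K / \<epsilon>) * exp (\<epsilon> * Re (\<gamma> t))) has_field_derivative
                 - (K / \<epsilon>) * (exp (\<epsilon> * Re (\<gamma> t)) * (\<epsilon> * Re (g t)))) (at t)"
      by (intro DERIV_cmult DERIV_fun_exp)
    also have "- (K / \<epsilon>) * (exp (\<epsilon> * Re (\<gamma> t)) * (\<epsilon> * Re (g t))) = G t"
      using t \<epsilon> by (simp add: G_def)
    finally have "((\<lambda>t. - (K / \<epsilon>) * exp (\<epsilon> * Re (\<gamma> t))) has_field_derivative G t) (at t)" .
    then show "((\<lambda>t. - (K / \<epsilon>) * exp (\<epsilon> * Re (\<gamma> t))) has_vector_derivative G t) (at t)"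
      by (simp add: has_real_derivative_iff_has_vector_derivative)
  next
    show "continuous_on {u..v} (\<lambda>t. - (K / \<epsilon>) * exp (\<epsilon> * Re (\<gamma> t)))"
      by (intro continuous_intros cont)
  qed
  have "f' integrable_on {u..v}"
    by (rule integrable_spike_finite[OF fin _ int]) (auto simp: f'_def)
  moreover have "norm (f' t) \<le> G t" if "t \<in> {u..v}" for t
  proof (cases "t \<in> S'")
    case False
    then have "norm (f t) * norm (g t) \<le> exp (\<epsilon> * Re (\<gamma> t)) * (K * (- Re (g t)))"
      using that uv by (intro mult_mono bound derivative_bound) (auto simp: S'_def)
    then show ?thesis
      using False by (simp add: f'_def G_def norm_mult)
  qed (simp add: f'_def G_def)
  ultimately have "norm (integral {u..v} f') \<le> integral {u..v} G"
    using G by (intro Henstock_Kurzweil_Integration.integral_norm_bound_integral) (auto simp: integrable_on_def)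
  also have "integral {u..v} G = - (K / \<epsilon>) * exp (\<epsilon> * Re (\<gamma> v)) - (- (K / \<epsilon>) * exp (\<epsilon> * Re (\<gamma> u)))"
    using G by (rule integral_unique)
  also have "integral {u..v} f' = integral {u..v} (\<lambda>t. f t * g t)"
    by (rule integral_spike[OF negligible_finite[OF fin]]) (auto simp: f'_def)
  finally show ?thesis
    by (simp add: algebra_simps)
qed

text \<open>Increments of F are at most (K/\<epsilon>)(E u - E v), and E tends to 0 with Re \<gamma>
  tending to -infinity. Completeness is applied along the integers only; letting n tend to infinity
  in \<open>diff\<close> carries the limit over to real v.\<close>

lemma improper_integral_along_monotone_curve:
  fixes \<gamma> :: "real \<Rightarrow> complex" and g f :: "real \<Rightarrow> complex" and K \<epsilon> T :: real
  assumes mono: "\<And>s t. T \<le> s \<Longrightarrow> s \<le> t \<Longrightarrow> dist (\<gamma> s) (\<gamma> t) \<le> K * (Re (\<gamma> s) - Re (\<gamma> t))"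
    and bound: "\<forall>\<^sub>F t in at_top. norm (f t) \<le> exp (\<epsilon> * Re (\<gamma> t))"
    and \<epsilon>: "\<epsilon> > 0"
    and lim: "filterlim (\<lambda>t. Re (\<gamma> t)) at_bot at_top"
    and cont: "continuous_on UNIV \<gamma>"
    and deriv: "\<And>u v. u < v \<Longrightarrow> \<exists>S. finite S \<and> (\<forall>t\<in>{u<..<v} - S. (\<gamma> has_vector_derivative g t) (at t))"
    and int: "\<And>u v. (\<lambda>t. f t * g t) integrable_on {u..v}"
  shows "\<exists>L. ((\<lambda>v. integral {0..v} (\<lambda>t. f t * g t)) \<longlongrightarrow> L) at_top"
proof -
  define F where "F v = integral {0..v} (\<lambda>t. f t * g t)" for v
  define E where "E t = exp (\<epsilon> * Re (\<gamma> t))" for t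
  obtain T' where T': "\<And>t. t \<ge> T' \<Longrightarrow> norm (f t) \<le> exp (\<epsilon> * Re (\<gamma> t))"
    using bound by (auto simp: eventually_at_top_linorder)
  \<comment> \<open>The 0 puts the base point of F to the left of u, as the splitting of the
    integral at u requires.\<close>
  define T0 where "T0 = max 0 (max T T')"
  have E0: "(E \<longlongrightarrow> 0) at_top"
    unfolding E_def
    by (intro filterlim_compose[OF exp_at_bot] filterlim_tendsto_pos_mult_at_bot[OF tendsto_const \<epsilon> lim])
  have diff: "norm (F v - F u) \<le> K / \<epsilon> * (E u - E v)" if uv: "T0 \<le> u" "u \<le> v" for u v
  proof (cases "u < v")
    case True
    obtain S where S: "finite S" "\<forall>t\<in>{u<..<v} - S. (\<gamma> has_vector_derivative g t) (at t)"
      using deriv[OF True] by blast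
    have "F v - F u = integral {u..v} (\<lambda>t. f t * g t)"
      unfolding F_def using Henstock_Kurzweil_Integration.integral_combine[where a=0 and c=u and b=v and f="\<lambda>t. f t * g t"] int uv
      by (simp add: T0_def algebra_simps)
    moreover have "norm (integral {u..v} (\<lambda>t. f t * g t)) \<le> K / \<epsilon> * (E u - E v)"
      unfolding E_def
      using S uv int
      by (intro integral_along_monotone_curve_bound[of T0 \<gamma> K f \<epsilon> u v S g] mono T' \<epsilon>
            continuous_on_subset[OF cont]) (auto simp: T0_def)
    ultimately show ?thesis
      by simp
  qed (use uv in simp)
  have "Cauchy (\<lambda>n. F (real n))"
  proof (rule CauchyI)
    fix e :: real assume "e > 0"
    have "((\<lambda>t. K / \<epsilon> * E t) \<longlongrightarrow> 0) at_top"
      by (intro tendsto_mult_right_zero E0)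
    then have "\<forall>\<^sub>F t in at_top. dist (K / \<epsilon> * E t) 0 < e / 2"
      using \<open>e > 0\<close> by (intro tendstoD) auto
    then obtain T1 where T1: "\<And>t. t \<ge> T1 \<Longrightarrow> \<bar>K / \<epsilon> * E t\<bar> < e / 2"
      by (auto simp: eventually_at_top_linorder)
    obtain M where M: "real M \<ge> max T0 T1"
      using real_arch_simple by blast
    have *: "norm (F (real k) - F (real l)) < e" if "M \<le> l" "l \<le> k" for k l
    proof -
      have "real M \<le> real l" "real l \<le> real k"
        using that by simp_all
      then have "norm (F (real k) - F (real l)) \<le> K / \<epsilon> * E l - K / \<epsilon> * E k" "T1 \<le> real l" "T1 \<le> real k"
        using diff[of "real l" "real k"] M by (auto simp: right_diff_distrib)
      then show ?thesis
        using T1[of "real l"] T1[of "real k"] by linarith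
    qed
    show "\<exists>M. \<forall>k\<ge>M. \<forall>l\<ge>M. norm (F (real k) - F (real l)) < e"
      using * by (metis nat_le_linear norm_minus_commute)
  qed
  then obtain L where L: "(\<lambda>n. F (real n)) \<longlonglongrightarrow> L"
    using Cauchy_convergent convergent_def by blast
  have "norm (F v - L) \<le> K / \<epsilon> * E v" if v: "v \<ge> T0" for v
  proof -
    have "(\<lambda>n. K / \<epsilon> * (E v - E (real n))) \<longlonglongrightarrow> K / \<epsilon> * (E v - 0)"
      by (intro tendsto_intros filterlim_compose[OF E0 filterlim_real_sequentially])
    moreover have "(\<lambda>n. norm (F (real n) - F v)) \<longlonglongrightarrow> norm (L - F v)"
      by (intro tendsto_intros L)
    moreover have "\<forall>\<^sub>F n in sequentially. norm (F (real n) - F v) \<le> K / \<epsilon> * (E v - E (real n))"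
      using filterlim_real_sequentially[unfolded filterlim_at_top, rule_format, of v]
      by eventually_elim (rule diff[OF v])
    ultimately have "norm (L - F v) \<le> K / \<epsilon> * (E v - 0)"
      by (intro tendsto_le[OF trivial_limit_sequentially])
    then show ?thesis
      by (simp add: norm_minus_commute)
  qed
  then have "\<forall>\<^sub>F v in at_top. norm (F v - L) \<le> K / \<epsilon> * E v"
    by (auto simp: eventually_at_top_linorder)
  then have "((\<lambda>v. F v - L) \<longlongrightarrow> 0) at_top"
    using tendsto_mult_right_zero[OF E0] by (rule Lim_null_comparison)
  then show ?thesis
    unfolding F_def[symmetric] using LIM_zero_cancel by blast
qed

text \<open>Affine substitution in the gauge integral; integrability of f(\<gamma>) g is enough, and
  finite length of the arc is not asked for.\<close>

lemma has_contour_integral_compose_linepath: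
  fixes \<gamma> :: "real \<Rightarrow> complex"
  assumes uv: "u < v"
    and S: "finite S" "\<And>t. t \<in> {u<..<v} - S \<Longrightarrow> (\<gamma> has_vector_derivative g t) (at t)"
    and int: "(\<lambda>t. f (\<gamma> t) * g t) integrable_on {u..v}"
  shows "(f has_contour_integral integral {u..v} (\<lambda>t. f (\<gamma> t) * g t)) (\<gamma> \<circ> linepath u v)"
proof -
  let ?I = "integral {u..v} (\<lambda>t. f (\<gamma> t) * g t)"
  have lp: "linepath u v = (\<lambda>x. (v - u) * x + u)"
    by (auto simp: linepath_def algebra_simps)
  have *: "((\<lambda>x. f (\<gamma> ((v - u) * x + u)) * g ((v - u) * x + u)) has_integral (1 / (v - u)) * ?I) {0..1}"
    using int uv unfolding has_integral_integral
    apply simp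
    apply (drule has_integral_affinity [where m="v-u" and c=u, simplified])
    apply (simp_all add: image_affinity_atLeastAtMost_div_diff scaleR_conv_of_real)
    apply (simp add: divide_simps)
    done
  \<comment> \<open>Parameters that are mapped to u or v join the exceptional set, since the
    derivative is given only in the open interval.\<close>
  define S' where "S' = (\<lambda>t. (v - u) * t + u) -` insert u (insert v S)"
  have fin: "finite S'"
    unfolding S'_def using S(1) uv by (intro finite_vimageI) (auto simp: inj_on_def)
  have vd: "vector_derivative (\<gamma> \<circ> linepath u v) (at x) = (v - u) *\<^sub>R g ((v - u) * x + u)"
    if x: "x \<in> {0..1} - S'" for x
  proof (rule vector_derivative_at)
    have "(v - u) * x + u \<ge> u" "(v - u) * x + u \<le> v" "(v - u) * x + u \<noteq> u" "(v - u) * x + u \<noteq> v"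
      using x uv mult_left_le[of x "v - u"] by (auto simp: S'_def algebra_simps)
    then have "(v - u) * x + u \<in> {u<..<v} - S"
      using x by (auto simp: S'_def)
    then show "(\<gamma> \<circ> linepath u v has_vector_derivative (v - u) *\<^sub>R g ((v - u) * x + u)) (at x)"
      unfolding lp by (intro vector_diff_chain_at S(2)) (auto intro!: derivative_eq_intros)
  qed
  have "((\<lambda>x. (v - u) *\<^sub>R (f (\<gamma> ((v - u) * x + u)) * g ((v - u) * x + u))) has_integral ?I) {0..1}"
    using has_integral_cmul[OF *, of "v - u"] uv by (simp add: scaleR_conv_of_real)
  then show ?thesis
    unfolding has_contour_integral
    by (rule has_integral_spike_finite[OF fin, rotated])
       (use vd in \<open>auto simp: lp\<close>)
qed

lemma left_loop_continuous:
  assumes "left_loop \<gamma>"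
  shows "continuous_on UNIV \<gamma>"
proof (rule continuous_at_imp_continuous_on, rule ballI)
  fix t :: real
  have "path (\<gamma> \<circ> linepath (t - 1) (t + 1))"
    using assms by (auto simp: left_loop_def valid_path_imp_path)
  then have "continuous_on {0..1} (\<gamma> \<circ> linepath (t - 1) (t + 1))"
    by (simp add: path_def)
  moreover have "continuous_on {t-1..t+1} (\<lambda>x. (x - (t - 1)) / 2)" 
    by (intro continuous_intros) auto
  ultimately have "continuous_on {t-1..t+1} (\<lambda>x. (\<gamma> \<circ> linepath (t - 1) (t + 1)) ((x - (t - 1)) / 2))"
    by (rule continuous_on_compose2) auto
  moreover have "(\<gamma> \<circ> linepath (t - 1) (t + 1)) ((x - (t - 1)) / 2) = \<gamma> x" for x
    unfolding o_def linepath_def by (rule arg_cong[of _ _ \<gamma>]) (simp add: field_simps)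
  ultimately have "continuous_on {t-1..t+1} \<gamma>"
    by simp
  then show "isCont \<gamma> t"
    by (simp add: continuous_on_interior)
qed

lemma left_loop_differentiable:
  assumes "left_loop \<gamma>" and uv: "u < v"
  shows "\<exists>S. finite S \<and> (\<forall>t\<in>{u<..<v} - S. (\<gamma> has_vector_derivative vector_derivative \<gamma> (at t)) (at t))"
proof -
  let ?p = "\<lambda>x. (x - u) / (v - u)"
  have "valid_path (\<gamma> \<circ> linepath u v)"
    using assms by (auto simp: left_loop_def)
  then obtain S where S: "finite S" "\<And>x. x \<in> {0..1} - S \<Longrightarrow> (\<gamma> \<circ> linepath u v) differentiable at x"
    unfolding piecewise_C1_differentiable_on_def C1_differentiable_on_eq valid_path_def by blast
  have "finite (?p -` S)"
    using S(1) uv by (intro finite_vimageI) (auto simp: inj_on_def)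
  moreover have "(\<gamma> has_vector_derivative vector_derivative \<gamma> (at t)) (at t)" if t: "t \<in> {u<..<v} - ?p -` S" for t
  proof -
    have "(\<gamma> \<circ> linepath u v) differentiable at (?p t)"
      using t uv by (intro S) (auto simp: divide_simps)
    moreover have "?p differentiable at t"
      using uv by (auto intro!: derivative_intros)
    ultimately have "((\<gamma> \<circ> linepath u v) \<circ> ?p) differentiable at t"
      by (simp add: differentiable_chain_at)
    moreover have "(\<gamma> \<circ> linepath u v) \<circ> ?p = \<gamma>"
    proof -
      have "linepath u v (?p x) = x" for x
      proof -
        have "linepath u v y = u + y * (v - u)" for y
          by (simp add: linepath_def algebra_simps)
        then show ?thesis
          using uv by simp
      qed
      then show ?thesis
        by (simp add: o_def)
    qed
    ultimately show ?thesis
      by (simp add: vector_derivative_works)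
  qed
  ultimately show ?thesis
    by blast
qed

text \<open>Splitting at the parameter 0 separates the two ends, and the substitution of -t for t
  turns the lower end into an upper one, so that one convergence lemma serves both.\<close>

lemma has_loop_integral_if_exponential_decay:
  fixes f :: "complex \<Rightarrow> complex" and \<epsilon> :: real
  assumes loop: "left_loop \<gamma>"
    and int: "\<And>u v. (\<lambda>t. f (\<gamma> t) * vector_derivative \<gamma> (at t)) integrable_on {u..v}"
    and \<epsilon>: "\<epsilon> > 0"
    and decay: "\<forall>\<^sub>F t in at_top. norm (f (\<gamma> t)) \<le> exp (\<epsilon> * Re (\<gamma> t))"
               "\<forall>\<^sub>F t in at_bot. norm (f (\<gamma> t)) \<le> exp (\<epsilon> * Re (\<gamma> t))"
  shows "\<exists>I. has_loop_integral f I \<gamma>"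
proof -
  let ?g = "\<lambda>t. vector_derivative \<gamma> (at t)"
  let ?h = "\<lambda>t. f (\<gamma> t) * ?g t"
  obtain T K where TK: "\<And>s t. T \<le> s \<Longrightarrow> s \<le> t \<Longrightarrow> dist (\<gamma> s) (\<gamma> t) \<le> K * (Re (\<gamma> s) - Re (\<gamma> t)) \<and>
        dist (\<gamma> (- s)) (\<gamma> (- t)) \<le> K * (Re (\<gamma> (- s)) - Re (\<gamma> (- t)))"
    using loop unfolding left_loop_def by blast
  have lim: "filterlim (\<lambda>t. Re (\<gamma> t)) at_bot at_top" "filterlim (\<lambda>t. Re (\<gamma> t)) at_bot at_bot"
    using loop unfolding left_loop_def by auto
  note cont = left_loop_continuous[OF loop] and deriv = left_loop_differentiable[OF loop]
  obtain L1 where L1: "((\<lambda>v. integral {0..v} ?h) \<longlongrightarrow> L1) at_top"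
    using improper_integral_along_monotone_curve[OF _ decay(1) \<epsilon> lim(1) cont deriv int] TK by metis
  have "\<exists>L. ((\<lambda>v. integral {0..v} (\<lambda>t. f (\<gamma> (- t)) * (- ?g (- t)))) \<longlongrightarrow> L) at_top"
  proof (rule improper_integral_along_monotone_curve[of T "\<lambda>t. \<gamma> (- t)" K _ \<epsilon>])
    show "\<forall>\<^sub>F t in at_top. cmod (f (\<gamma> (- t))) \<le> exp (\<epsilon> * Re (\<gamma> (- t)))"
      using decay(2) by (simp add: at_bot_mirror eventually_filtermap)
    show "filterlim (\<lambda>t. Re (\<gamma> (- t))) at_bot at_top"
      using lim(2) filterlim_compose filterlim_uminus_at_bot_at_top by blast
    show "continuous_on UNIV (\<lambda>t. \<gamma> (- t))"
      by (intro continuous_intros continuous_on_compose2[OF cont]) auto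
    show "(\<lambda>t. f (\<gamma> (- t)) * - ?g (- t)) integrable_on {u..v}" for u v
    proof -
      have "(\<lambda>t. ?h (- t)) integrable_on {u..v}"
        using int[of "- v" "- u"] Henstock_Kurzweil_Integration.integrable_reflect_real[where f="?h" and a="-v" and b="-u"] by simp
      then show ?thesis
        using integrable_neg by fastforce
    qed
    show "\<exists>S. finite S \<and> (\<forall>t\<in>{u<..<v} - S. ((\<lambda>t. \<gamma> (- t)) has_vector_derivative - ?g (- t)) (at t))"
      if "u < v" for u v
    proof -
      obtain S where S: "finite S" "\<forall>t\<in>{-v<..<-u} - S. (\<gamma> has_vector_derivative ?g t) (at t)"
        using deriv[of "-v" "-u"] \<open>u < v\<close> by auto
      have "((\<lambda>t. \<gamma> (- t)) has_vector_derivative - ?g (- t)) (at t)" if "t \<in> {u<..<v} - uminus ` S" for t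
      proof -
        have "- t \<in> {-v<..<-u} - S"
          using that by (auto simp: image_iff)
        then have "(\<gamma> \<circ> uminus has_vector_derivative (-1) *\<^sub>R ?g (- t)) (at t)"
          using S(2) by (intro vector_diff_chain_at) (auto intro!: derivative_eq_intros)
        then show ?thesis
          by (simp add: o_def)
      qed
      then show ?thesis
        using S(1) by blast
    qed
  qed (use TK \<epsilon> in auto)
  then obtain L2 where L2: "((\<lambda>v. integral {0..v} (\<lambda>t. f (\<gamma> (- t)) * (- ?g (- t)))) \<longlongrightarrow> L2) at_top"
    by blast
  have "integral {0..v} (\<lambda>t. f (\<gamma> (- t)) * (- ?g (- t))) = - integral {- v..0} ?h" for v
    using Henstock_Kurzweil_Integration.integral_reflect_real[where a="-v" and b=0 and f="?h"] by simp
  then have "((\<lambda>v. integral {- v..0} ?h) \<longlongrightarrow> - L2) at_top"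
    using tendsto_minus[OF L2] by simp
  then have L2': "((\<lambda>u. integral {u..0} ?h) \<longlongrightarrow> - L2) at_bot"
    by (simp add: at_bot_mirror filterlim_filtermap)
  have ci: "(f has_contour_integral integral {u..v} ?h) (\<gamma> \<circ> linepath u v)" if uv: "u \<le> v" for u v
  proof (cases "u = v")
    case True
    have "\<gamma> \<circ> linepath v v = linepath (\<gamma> v) (\<gamma> v)"
      by (simp add: o_def linepath_refl)
    then show ?thesis
      using True by simp
  next
    case False
    then obtain S where "finite S" "\<forall>t\<in>{u<..<v} - S. (\<gamma> has_vector_derivative ?g t) (at t)"
      using deriv[of u v] uv by auto
    then show ?thesis
      using has_contour_integral_compose_linepath[of u v S \<gamma> ?g f] False uv int by auto
  qed
  \<comment> \<open>Each summand depends on one end parameter alone, so its limit transfers to the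
    product filter along a projection.\<close>
  have "((\<lambda>(u, v). integral {u..0} ?h + integral {0..v} ?h) \<longlongrightarrow> - L2 + L1) (at_bot \<times>\<^sub>F at_top)"
    unfolding case_prod_unfold
    by (intro tendsto_add filterlim_compose[OF L2' filterlim_fst] filterlim_compose[OF L1 filterlim_snd])
  moreover have "\<forall>\<^sub>F (u, v) in at_bot \<times>\<^sub>F at_top.
     integral {u..0} ?h + integral {0..v} ?h = contour_integral (\<gamma> \<circ> linepath u v) f"
  proof -
    have "\<forall>\<^sub>F x in at_bot \<times>\<^sub>F at_top. fst x \<le> (0::real) \<and> snd x \<ge> (0::real)"
      by (intro eventually_prodI eventually_le_at_bot eventually_ge_at_top)
    then show ?thesis
    proof (eventually_elim, clarify)
      fix u v :: real assume uv: "fst (u, v) \<le> 0" "0 \<le> snd (u, v)"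
      have "contour_integral (\<gamma> \<circ> linepath u v) f = integral {u..v} ?h"
        using ci[of u v] uv by (simp add: contour_integral_unique)
      moreover have "integral {u..0} ?h + integral {0..v} ?h = integral {u..v} ?h"
        using uv int by (intro Henstock_Kurzweil_Integration.integral_combine) auto
      ultimately show "integral {u..0} ?h + integral {0..v} ?h = contour_integral (\<gamma> \<circ> linepath u v) f"
        by simp
    qed
  qed
  ultimately have "((\<lambda>(u, v). contour_integral (\<gamma> \<circ> linepath u v) f) \<longlongrightarrow> - L2 + L1) (at_bot \<times>\<^sub>F at_top)"
    by (rule Lim_transform_eventually[OF _ eventually_mono]) auto
  then show ?thesis
    unfolding has_loop_integral_def using ci contour_integrable_on_def by blast
qed

section \<open>Multivalued functions with power-like germs\<close>

text \<open>Here \<open>l\<close> ranges over all logarithms of s - s0, so no cut is fixed, and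
  \<omega> may depend on the point, the value and the logarithm. Countability of \<Omega> is what
  later forces \<omega> to be constant along a curve. The centre has no logarithm; for c > 0 the
  clause on \<open>V s0\<close> states the value 0 there. That h has no zeros allows division by
  it.\<close>

definition power_germ :: "complex \<Rightarrow> (complex \<Rightarrow> complex set) \<Rightarrow> bool" where
  "power_germ s0 V \<longleftrightarrow>
     (\<exists>c r h \<Omega>. 0 \<le> c \<and> (0 < c \<longrightarrow> V s0 \<subseteq> {0}) \<and> 0 < r \<and> h holomorphic_on ball s0 r \<and>
        (\<forall>s\<in>ball s0 r. h s \<noteq> 0) \<and> countable \<Omega> \<and>
        (\<forall>s\<in>ball s0 r - {s0}. \<forall>v\<in>V s. \<forall>l. exp l = s - s0 \<longrightarrow>
           (\<exists>\<omega>\<in>\<Omega>. v = \<omega> * exp (of_real c * l) * h s)))"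

text \<open>Exponents add and the constants multiply, so the exponent stays nonnegative and the set
  of constants countable. If the sum of the exponents is positive, so is one of them, and the
  corresponding set at s0 lies in {0}.\<close>

lemma power_germ_mult:
  assumes "power_germ s0 V" "power_germ s0 W"
  shows "power_germ s0 (\<lambda>s. V s * W s)"
proof -
  obtain c1 r1 h1 \<Omega>1 where 1: "0 \<le> c1" "0 < c1 \<Longrightarrow> V s0 \<subseteq> {0}" "0 < r1" "h1 holomorphic_on ball s0 r1"
     "\<And>s. s \<in> ball s0 r1 \<Longrightarrow> h1 s \<noteq> 0" "countable \<Omega>1"
     "\<And>s v l. s \<in> ball s0 r1 - {s0} \<Longrightarrow> v \<in> V s \<Longrightarrow> exp l = s - s0 \<Longrightarrow>
        (\<exists>\<omega>\<in>\<Omega>1. v = \<omega> * exp (of_real c1 * l) * h1 s)"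
    using assms(1) unfolding power_germ_def by (elim exE conjE) metis
  obtain c2 r2 h2 \<Omega>2 where 2: "0 \<le> c2" "0 < c2 \<Longrightarrow> W s0 \<subseteq> {0}" "0 < r2" "h2 holomorphic_on ball s0 r2"
     "\<And>s. s \<in> ball s0 r2 \<Longrightarrow> h2 s \<noteq> 0" "countable \<Omega>2"
     "\<And>s v l. s \<in> ball s0 r2 - {s0} \<Longrightarrow> v \<in> W s \<Longrightarrow> exp l = s - s0 \<Longrightarrow>
        (\<exists>\<omega>\<in>\<Omega>2. v = \<omega> * exp (of_real c2 * l) * h2 s)"
    using assms(2) unfolding power_germ_def by (elim exE conjE) metis
  show ?thesis
    unfolding power_germ_def
  proof (intro exI conjI ballI allI impI)
    show "0 \<le> c1 + c2" "0 < min r1 r2"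
      using 1 2 by auto
    show "(\<lambda>s. h1 s * h2 s) holomorphic_on ball s0 (min r1 r2)"
      using 1(4) 2(4) by (intro holomorphic_intros) (auto elim: holomorphic_on_subset)
    show "countable ((\<lambda>(x, y). x * y) ` (\<Omega>1 \<times> \<Omega>2))"
      using 1(6) 2(6) by simp
    show "V s0 * W s0 \<subseteq> {0}" if "0 < c1 + c2"
    proof -
      have "0 < c1 \<or> 0 < c2"
        using that by linarith
      then show ?thesis
        using 1(2) 2(2) by (auto elim!: set_times_elim)
    qed
    show "h1 s * h2 s \<noteq> 0" if "s \<in> ball s0 (min r1 r2)" for s
      using that 1(5) 2(5) by auto
    fix s u l assume s: "s \<in> ball s0 (min r1 r2) - {s0}" and u: "u \<in> V s * W s" and l: "exp l = s - s0"
    from u obtain v w where vw: "u = v * w" "v \<in> V s" "w \<in> W s"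
      by (auto elim: set_times_elim)
    obtain \<omega>1 where \<omega>1: "\<omega>1 \<in> \<Omega>1" "v = \<omega>1 * exp (of_real c1 * l) * h1 s"
      using 1(7)[OF _ vw(2) l] s by auto
    obtain \<omega>2 where \<omega>2: "\<omega>2 \<in> \<Omega>2" "w = \<omega>2 * exp (of_real c2 * l) * h2 s"
      using 2(7)[OF _ vw(3) l] s by auto
    have "u = (\<omega>1 * \<omega>2) * exp (of_real (c1 + c2) * l) * (h1 s * h2 s)"
      by (simp add: vw(1) \<omega>1(2) \<omega>2(2) exp_add distrib_right)
    then show "\<exists>\<omega>\<in>(\<lambda>(x, y). x * y) ` (\<Omega>1 \<times> \<Omega>2). u = \<omega> * exp (of_real (c1 + c2) * l) * (h1 s * h2 s)"
      using \<omega>1(1) \<omega>2(1) by force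
  qed
qed

lemma power_germ_holomorphic:
  assumes "h holomorphic_on ball s0 r" "0 < r" "\<And>s. s \<in> ball s0 r \<Longrightarrow> h s \<noteq> 0"
  shows "power_germ s0 (\<lambda>s. {h s})"
  unfolding power_germ_def
  using assms by (intro exI[of _ 0] exI[of _ r] exI[of _ h] exI[of _ "{1}"]) auto

lemma power_germ_prod:
  assumes "\<And>j. j \<in> J \<Longrightarrow> power_germ s0 (V j)"
  shows "power_germ s0 (\<lambda>s. \<Prod>j\<in>J. V j s)"
proof (cases "finite J")
  case True
  then show ?thesis
    using assms
  proof (induction J)
    case empty
    then show ?case
      using power_germ_holomorphic[of "\<lambda>_. 1" s0 1] by simp
  qed (simp add: power_germ_mult)
next
  case False
  then show ?thesis
    using power_germ_holomorphic[of "\<lambda>_. 1" s0 1] by simp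
qed

text \<open>With N the order of the zero, G(s) = (s - s0)^N exp(g(s)). Every logarithm of G(s) is N
  l + g(s) + 2 \<pi> i k, so every value of the power is exp(2 \<pi> i k c) exp(c N l) exp(c g(s)).
  The exponent of the germ is c N, and the constants are indexed by the integers k.\<close>

lemma power_germ_power_values:
  assumes hol: "G holomorphic_on ball s0 r0" and r0: "0 < r0" and nz: "\<exists>s\<in>ball s0 r0. G s \<noteq> 0" and c: "0 < c"
  shows "power_germ s0 (\<lambda>s. power_values (G s) c)"
proof -
  define N where "N = nat (zorder G s0)"
  obtain r where r: "r > 0" "cball s0 r \<subseteq> ball s0 r0" "zor_poly G s0 holomorphic_on cball s0 r"
      "\<And>w. w \<in> cball s0 r \<Longrightarrow> G w = zor_poly G s0 w * (w - s0) ^ N \<and> zor_poly G s0 w \<noteq> 0"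
    and N: "if G s0 = 0 then zorder G s0 > 0 else zorder G s0 = 0"
    unfolding N_def
    using zorder_exist_zero[OF hol open_ball connected_ball centre_in_ball[THEN iffD2, OF r0] nz] by blast
  obtain g where g: "g holomorphic_on ball s0 r" "\<And>w. w \<in> ball s0 r \<Longrightarrow> exp (g w) = zor_poly G s0 w"
  proof (rule holomorphic_logarithm_exists[of "ball s0 r" "zor_poly G s0" s0])
    show "zor_poly G s0 holomorphic_on ball s0 r"
      using r(3) by (rule holomorphic_on_subset) auto
  qed (use r in auto)
  show ?thesis
    unfolding power_germ_def
  proof (intro exI conjI ballI allI impI)
    show "0 \<le> c * N"
      using c by simp
    show "power_values (G s0) c \<subseteq> {0}" if "0 < c * N"
      using N that by (auto simp: power_values_def N_def split: if_splits)
    show "0 < r"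
      by fact
    show "(\<lambda>s. exp (of_real c * g s)) holomorphic_on ball s0 r"
      by (intro holomorphic_intros g)
    show "exp (of_real c * g s) \<noteq> 0" for s
      by simp
    show "countable (range (\<lambda>k::int. exp (of_real c * (of_int (2 * k) * (of_real pi * \<i>)))))"
      by simp
    fix s v l assume s: "s \<in> ball s0 r - {s0}" and v: "v \<in> power_values (G s) c" and l: "exp l = s - s0"
    have "G s = exp (of_nat N * l + g s)"
      using s r(4)[of s] by (simp add: exp_add exp_of_nat_mult l g(2))
    moreover from this obtain l' where l': "v = exp (of_real c * l')" "exp l' = G s"
      using v by (auto simp: power_values_def split: if_splits)
    ultimately obtain k :: int where "l' = of_nat N * l + g s + of_int (2 * k) * (of_real pi * \<i>)"
      by (metis exp_eq mult.assoc of_int_mult of_real_mult of_real_of_int_eq)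
    then have "v = exp (of_real c * (of_int (2 * k) * (of_real pi * \<i>))) * exp (of_real (c * N) * l) * exp (of_real c * g s)"
      by (simp add: l'(1) exp_add[symmetric] algebra_simps)
    then show "\<exists>\<omega>\<in>range (\<lambda>k::int. exp (of_real c * (of_int (2 * k) * (of_real pi * \<i>)))).
        v = \<omega> * exp (of_real (c * N) * l) * exp (of_real c * g s)"
      by blast
  qed
qed

text \<open>The equation says exactly that (s - s0)^(c+1) P is a primitive of (s - s0)^c h.
  Comparing Taylor coefficients gives (n + 1 + c) d_n = a_n; as c \<ge> 0, the divisors have modulus
  at least 1 and the series for P is dominated by that for h.\<close>

lemma holomorphic_Euler_equation:
  fixes h :: "complex \<Rightarrow> complex"
  assumes hol: "h holomorphic_on ball s0 r" and c: "0 \<le> c"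
  obtains P P' where "\<And>s. s \<in> ball s0 r \<Longrightarrow> (P has_field_derivative P' s) (at s)"
    "\<And>s. s \<in> ball s0 r \<Longrightarrow> (s - s0) * P' s + (1 + of_real c) * P s = h s"
proof -
  define a where "a n = (deriv ^^ n) h s0 / fact n" for n
  define d where "d n = a n / (of_nat n + 1 + of_real c)" for n
  have sums_a: "(\<lambda>n. a n * x ^ n) sums h (s0 + x)" if "norm x < r" for x
    unfolding a_def using holomorphic_power_series[OF hol, of "s0 + x"] that by (simp add: dist_norm)
  have norm_ge: "1 \<le> norm (of_nat n + 1 + complex_of_real c)" for n
  proof -
    have "of_nat n + 1 + complex_of_real c = of_real (real n + 1 + c)"
      by simp
    then show ?thesis
      using c norm_of_real[of "real n + 1 + c", where 'a = complex] by simp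
  qed
  have norm_d: "norm (d n * x ^ n) \<le> norm (a n * x ^ n)" for n x
  proof -
    have "norm (d n * x ^ n) = norm (a n * x ^ n) / norm (of_nat n + 1 + complex_of_real c)"
      by (simp add: d_def norm_mult norm_divide)
    also have "\<dots> \<le> norm (a n * x ^ n) / 1"
      using norm_ge[of n] by (intro divide_left_mono) auto
    finally show ?thesis
      by simp
  qed
  have summable_d: "summable (\<lambda>n. d n * x ^ n)" if "norm x < r" for x
  proof -
    \<comment> \<open>Absolute convergence at x follows from convergence at a real y with |x| < y <
      r.\<close>
    have "summable (\<lambda>n. norm (a n * x ^ n))"
    proof -
      obtain y where y: "norm x < y" "y < r"
        using \<open>norm x < r\<close> dense by blast
      have "0 < y"
        using y(1) norm_ge_zero[of x] by linarith
      then have "summable (\<lambda>n. a n * (of_real y) ^ n)"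
        using sums_a[of "of_real y"] y by (auto simp: sums_iff)
      then show ?thesis
        using powser_insidea[of a "of_real y" x] y \<open>0 < y\<close> by simp
    qed
    then show ?thesis
      by (rule summable_comparison_test'[of _ 0]) (use norm_d in simp)
  qed
  define P where "P s = (\<Sum>n. d n * (s - s0) ^ n)" for s
  define P' where "P' s = (\<Sum>n. diffs d n * (s - s0) ^ n)" for s
  have deriv: "(P has_field_derivative P' s) (at s)" if "s \<in> ball s0 r" for s
  proof -
    have "((\<lambda>x. \<Sum>n. d n * x ^ n) has_field_derivative P' s) (at (s - s0))"
      unfolding P'_def using that summable_d
      by (intro termdiffs_strong'[of r]) (auto simp: dist_norm norm_minus_commute)
    then have "((\<lambda>x. \<Sum>n. d n * x ^ n) \<circ> (\<lambda>s. s - s0) has_field_derivative P' s * 1) (at s)"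
      by (intro DERIV_chain) (auto intro!: derivative_eq_intros)
    then show ?thesis
      by (simp add: o_def P_def[abs_def])
  qed
  have "(s - s0) * P' s + (1 + of_real c) * P s = h s" if s: "s \<in> ball s0 r" for s
  proof -
    define x where "x = s - s0"
    have x: "norm x < r"
      using s by (simp add: x_def dist_norm norm_minus_commute)
    have "summable (\<lambda>n. diffs d n * x ^ n)"
      using x summable_d by (intro termdiff_converges[of _ r]) auto
    from diffs_equiv[OF this] have "(\<lambda>n. x * (of_nat n * d n * x ^ (n - Suc 0))) sums (x * P' s)"
      unfolding P'_def x_def by (rule sums_mult)
    moreover have "x * (of_nat n * d n * x ^ (n - Suc 0)) = of_nat n * d n * x ^ n" for n
      by (cases n) (auto simp: mult_ac)
    ultimately have "(\<lambda>n. of_nat n * d n * x ^ n) sums (x * P' s)"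
      by simp
    moreover have "(\<lambda>n. (1 + of_real c) * (d n * x ^ n)) sums ((1 + of_real c) * P s)"
      unfolding P_def x_def[symmetric] using summable_d[OF x] by (intro sums_mult summable_sums)
    ultimately have "(\<lambda>n. of_nat n * d n * x ^ n + (1 + of_real c) * (d n * x ^ n)) sums (x * P' s + (1 + of_real c) * P s)"
      by (rule sums_add)
    moreover have "of_nat n * d n * x ^ n + (1 + of_real c) * (d n * x ^ n) = a n * x ^ n" for n
    proof -
      have "of_nat n + 1 + complex_of_real c \<noteq> 0"
        using norm_ge[of n] by auto
      then have "a n = (of_nat n + 1 + of_real c) * d n"
        by (simp add: d_def)
      then show ?thesis
        by (simp add: algebra_simps)
    qed
    ultimately have "(\<lambda>n. a n * x ^ n) sums (x * P' s + (1 + of_real c) * P s)"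
      by simp
    with sums_a[OF x] show ?thesis
      using sums_unique2 by (fastforce simp: x_def)
  qed
  with deriv show ?thesis
    by (rule that)
qed

text \<open>Even where a path of unbounded variation meets a zero of the multivalued function,
  changing the branch infinitely often, the primitive \<open>\<psi> (s - s0) P / h\<close> stays differentiable:
  on each branch \<open>\<omega> (s - s0)\<^sup>c h\<close> it equals \<open>\<omega> (s - s0)\<^bsup>c+1\<^esup> P\<close>.\<close>
lemma power_germ_local_primitive:
  fixes \<gamma> \<psi> :: "real \<Rightarrow> complex"
  assumes germ: "power_germ (\<gamma> t0) V"
    and cont: "continuous_on UNIV \<gamma>" "continuous_on UNIV \<psi>"
    and vals: "\<And>t. \<psi> t \<in> V (\<gamma> t)"
  obtains d \<Phi> where "0 < d" "continuous_on (ball t0 d) \<Phi>"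
    "\<And>t g. t \<in> ball t0 d \<Longrightarrow> (\<gamma> has_vector_derivative g) (at t) \<Longrightarrow> (\<Phi> has_vector_derivative \<psi> t * g) (at t)"
proof -
  define s0 where "s0 = \<gamma> t0"
  obtain c r h \<Omega> where c: "0 \<le> c" "0 < c \<Longrightarrow> V s0 \<subseteq> {0}" and r: "0 < r" and h: "h holomorphic_on ball s0 r"
     "\<And>s. s \<in> ball s0 r \<Longrightarrow> h s \<noteq> 0" and \<Omega>: "countable \<Omega>"
     "\<And>s v l. s \<in> ball s0 r - {s0} \<Longrightarrow> v \<in> V s \<Longrightarrow> exp l = s - s0 \<Longrightarrow>
        (\<exists>\<omega>\<in>\<Omega>. v = \<omega> * exp (of_real c * l) * h s)"
    using germ unfolding power_germ_def s0_def by (elim exE conjE) metis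
  obtain P P' where P: "\<And>s. s \<in> ball s0 r \<Longrightarrow> (P has_field_derivative P' s) (at s)"
    "\<And>s. s \<in> ball s0 r \<Longrightarrow> (s - s0) * P' s + (1 + of_real c) * P s = h s"
    using holomorphic_Euler_equation[OF h(1) c(1)] by metis
  have cont_\<gamma>: "isCont \<gamma> t" and cont_\<psi>: "isCont \<psi> t" for t
    using cont by (auto simp: continuous_on_eq_continuous_at)
  obtain d where d: "0 < d" "\<And>t. t \<in> ball t0 d \<Longrightarrow> \<gamma> t \<in> ball s0 r"
    using cont_\<gamma>[of t0] r unfolding continuous_at_eps_delta s0_def
    by (metis dist_commute mem_ball)
  define Q where "Q t = \<psi> t * P (\<gamma> t) / h (\<gamma> t)" for t
  define \<Phi> where "\<Phi> t = Q t * (\<gamma> t - s0)" for t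
  have cont_P: "continuous_on (ball s0 r) P"
    using P(1) by (meson DERIV_isCont continuous_at_imp_continuous_on)
  have cont_Q: "continuous_on (ball t0 d) Q"
    unfolding Q_def
    by (intro continuous_intros continuous_on_compose2[OF cont_P] continuous_on_subset[OF cont(1)]
        continuous_on_compose2[OF holomorphic_on_imp_continuous_on[OF h(1)]] continuous_on_subset[OF cont(2)])
       (use d h in auto)
  have cont_\<Phi>: "continuous_on (ball t0 d) \<Phi>"
    unfolding \<Phi>_def by (intro continuous_intros cont_Q continuous_on_subset[OF cont(1)]) auto
  have "(\<Phi> has_vector_derivative \<psi> t * g) (at t)"
    if t: "t \<in> ball t0 d" and g: "(\<gamma> has_vector_derivative g) (at t)" for t g
  proof (cases "\<gamma> t = s0")
    case True
    \<comment> \<open>Since \<Phi> vanishes at t, its difference quotient is Q times that of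
      \<gamma>, and continuity of Q suffices. Its limit is right because Q t = \<psi> t: for c = 0
      the Euler equation at s0 reads P(s0) = h(s0), and for c > 0 both sides are 0.\<close>
    have "isCont Q t"
      using cont_Q t by (simp add: continuous_on_eq_continuous_at)
    have "((\<lambda>y. (\<gamma> y - \<gamma> t) /\<^sub>R (y - t)) \<longlongrightarrow> g) (at t)"
      using g by (simp add: has_vector_derivative_iff_quotient)
    then have "((\<lambda>y. Q y * ((\<gamma> y - \<gamma> t) /\<^sub>R (y - t))) \<longlongrightarrow> Q t * g) (at t)"
      using \<open>isCont Q t\<close> by (intro tendsto_mult) (auto simp: isCont_def)
    moreover have "Q t = \<psi> t"
    proof (cases "c = 0")
      case True
      have "P s0 = h s0"
        using P(2)[of s0] r True by simp
      then show ?thesis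
        using h(2)[of s0] r by (simp add: Q_def \<open>\<gamma> t = s0\<close>)
    next
      case False
      then have "\<psi> t = 0"
        using vals[of t] c \<open>\<gamma> t = s0\<close> by auto
      then show ?thesis
        by (simp add: Q_def)
    qed
    moreover have "(\<lambda>y. Q y * ((\<gamma> y - \<gamma> t) /\<^sub>R (y - t))) = (\<lambda>y. (\<Phi> y - \<Phi> t) /\<^sub>R (y - t))"
      by (simp add: \<Phi>_def True)
    ultimately show ?thesis
      unfolding has_vector_derivative_iff_quotient by metis
  next
    case False
    define s1 where "s1 = \<gamma> t"
    \<comment> \<open>A logarithm of s - s0 near s1: for s closer to s1 than s0 is, the quotient (s
      - s0)/(s1 - s0) has positive real part, so the principal logarithm is holomorphic
      there.\<close>
    define lg where "lg s = Ln ((s - s0) / (s1 - s0)) + Ln (s1 - s0)" for s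
    have s1: "s1 \<noteq> s0" "s1 \<in> ball s0 r"
      using False d(2)[OF t] by (auto simp: s1_def)
    define D where "D = ball s0 r \<inter> ball s1 (norm (s1 - s0))"
    have quot: "(s - s0) / (s1 - s0) \<notin> \<real>\<^sub>\<le>\<^sub>0" if "s \<in> D" for s
    proof -
      have "norm ((s - s0) / (s1 - s0) - 1) < 1"
      proof -
        have "(s - s0) / (s1 - s0) - 1 = (s - s1) / (s1 - s0)"
          using s1(1) by (simp add: field_simps)
        then show ?thesis
          using that s1(1) by (simp add: norm_divide D_def dist_norm norm_minus_commute)
      qed
      then have "Re ((s - s0) / (s1 - s0)) > 0"
        using abs_Re_le_cmod[of "(s - s0) / (s1 - s0) - 1"] by simp
      then show ?thesis
        by (auto simp: complex_nonpos_Reals_iff)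
    qed
    have D: "s \<noteq> s0" "s \<in> ball s0 r" if "s \<in> D" for s
      using that by (auto simp: D_def dist_norm)
    have exp_lg: "exp (lg s) = s - s0" if "s \<in> D" for s
      using s1(1) D(1)[OF that] by (simp add: lg_def exp_add)
    have deriv_lg: "(lg has_field_derivative 1 / (s - s0)) (at s)" if "s \<in> D" for s
    proof -
      have "((\<lambda>s. (s - s0) / (s1 - s0)) has_field_derivative 1 / (s1 - s0)) (at s)"
        using s1(1) by (auto intro!: derivative_eq_intros)
      from DERIV_add[OF DERIV_chain2[OF has_field_derivative_Ln[OF quot[OF that]] this] DERIV_const]
      have "(lg has_field_derivative inverse ((s - s0) / (s1 - s0)) * (1 / (s1 - s0)) + 0) (at s)"
        unfolding lg_def .
      then show ?thesis
        using s1(1) D(1)[OF that] by simp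
    qed
    have cont_lg: "continuous_on D lg"
      using deriv_lg by (meson DERIV_isCont continuous_at_imp_continuous_on)
    have "open D"
      by (auto simp: D_def)
    have "t \<in> \<gamma> -` D \<inter> ball t0 d"
      using t s1 by (auto simp: D_def s1_def)
    moreover have "open (\<gamma> -` D \<inter> ball t0 d)"
      by (intro open_Int open_ball open_vimage cont(1) \<open>open D\<close>)
    ultimately obtain d1 where d1: "0 < d1" "ball t d1 \<subseteq> \<gamma> -` D \<inter> ball t0 d"
      using open_contains_ball by metis
    define \<omega> where "\<omega> y = \<psi> y / (exp (of_real c * lg (\<gamma> y)) * h (\<gamma> y))" for y
    have cont_\<omega>: "continuous_on (ball t d1) \<omega>"
      unfolding \<omega>_def
      by (intro continuous_intros continuous_on_compose2[OF cont_lg] continuous_on_subset[OF cont(1)]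
          continuous_on_compose2[OF holomorphic_on_imp_continuous_on[OF h(1)]] continuous_on_subset[OF cont(2)])
         (use d1(2) d h in auto)
    have \<omega>_in: "\<omega> y \<in> \<Omega>" if y: "y \<in> ball t d1" for y
    proof -
      have "\<gamma> y \<in> D"
        using y d1 by auto
      then obtain w where w: "w \<in> \<Omega>" "\<psi> y = w * exp (of_real c * lg (\<gamma> y)) * h (\<gamma> y)"
        using \<Omega>(2)[of "\<gamma> y", OF _ vals exp_lg] D by blast
      then have "\<omega> y = w"
        using h(2) D(2)[OF \<open>\<gamma> y \<in> D\<close>] by (simp add: \<omega>_def)
      with w show ?thesis
        by simp
    qed
    \<comment> \<open>The continuous image of an interval is connected; being countable as well, it
      is a single point.\<close>
    have \<omega>_const: "\<omega> y = \<omega> t" if y: "y \<in> ball t d1" for y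
    proof -
      have "connected (\<omega> ` ball t d1)"
        by (intro connected_continuous_image cont_\<omega> connected_ball)
      moreover have "countable (\<omega> ` ball t d1)"
        using \<omega>_in by (intro countable_subset[OF _ \<Omega>(1)]) auto
      moreover have "\<omega> t \<in> \<omega> ` ball t d1"
        using d1(1) by (intro imageI) simp
      ultimately show ?thesis
        using connected_uncountable y by blast
    qed
    \<comment> \<open>With the constant frozen at t, M is holomorphic near s1, agrees with \<Phi>
      along the curve near t, and by the Euler equation has derivative \<psi> t at s1.\<close>
    define M where "M s = \<omega> t * (exp (of_real c * lg s) * ((s - s0) * P s))" for s
    have "s1 \<in> D"
      using s1 by (auto simp: D_def)
    then have "(M has_field_derivative
       \<omega> t * (exp (of_real c * lg s1) * (of_real c * (1 / (s1 - s0))) * ((s1 - s0) * P s1) +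
               (1 * P s1 + P' s1 * (s1 - s0)) * exp (of_real c * lg s1))) (at s1)"
      unfolding M_def using deriv_lg[OF \<open>s1 \<in> D\<close>] P(1)[OF s1(2)]
      by (intro DERIV_cmult DERIV_mult DERIV_fun_exp) (auto intro!: derivative_eq_intros)
    also have "\<omega> t * (exp (of_real c * lg s1) * (of_real c * (1 / (s1 - s0))) * ((s1 - s0) * P s1) +
               (1 * P s1 + P' s1 * (s1 - s0)) * exp (of_real c * lg s1)) =
               \<omega> t * (exp (of_real c * lg s1) * ((s1 - s0) * P' s1 + (1 + of_real c) * P s1))"
      using s1(1) by (simp add: field_simps)
    also have "\<dots> = \<psi> t"
      unfolding P(2)[OF s1(2)] using h(2)[OF s1(2)] by (simp add: \<omega>_def s1_def)
    finally have "(M has_field_derivative \<psi> t) (at (\<gamma> t))"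
      by (simp add: s1_def)
    then have "(M \<circ> \<gamma> has_vector_derivative g * \<psi> t) (at t)"
      by (rule field_vector_diff_chain_at[OF g])
    moreover have "(M \<circ> \<gamma>) y = \<Phi> y" if y: "y \<in> ball t d1" for y
    proof -
      have "\<gamma> y \<in> D"
        using y d1 by auto
      then have "\<psi> y = \<omega> y * exp (of_real c * lg (\<gamma> y)) * h (\<gamma> y)"
        using h(2) D(2) by (simp add: \<omega>_def)
      then have "\<psi> y = \<omega> t * exp (of_real c * lg (\<gamma> y)) * h (\<gamma> y)"
        by (simp only: \<omega>_const[OF y])
      then show ?thesis
        using h(2) D(2)[OF \<open>\<gamma> y \<in> D\<close>] by (simp add: M_def \<Phi>_def Q_def)
    qed
    ultimately show ?thesis
      using has_vector_derivative_transform_within_open[of "M \<circ> \<gamma>" _ t "ball t d1" \<Phi>] d1(1)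
      by (simp add: mult.commute)
  qed
  with d(1) cont_\<Phi> show ?thesis
    by (rule that)
qed

text \<open>Each local primitive makes the integrand gauge integrable on every small interval
  containing its centre; \<open>integrable_on_little_subintervals\<close> glues these by
  compactness.\<close>

lemma integrable_power_germ_along_path:
  fixes \<gamma> \<psi> :: "real \<Rightarrow> complex"
  assumes germ: "\<And>t. power_germ (\<gamma> t) V"
    and cont: "continuous_on UNIV \<gamma>" "continuous_on UNIV \<psi>"
    and vals: "\<And>t. \<psi> t \<in> V (\<gamma> t)"
    and deriv: "\<And>u v. u < v \<Longrightarrow> \<exists>S. finite S \<and> (\<forall>t\<in>{u<..<v} - S. (\<gamma> has_vector_derivative g t) (at t))"
  shows "(\<lambda>t. \<psi> t * g t) integrable_on {u..v}"
proof -
  have "\<exists>d>0. \<forall>u v. t0 \<in> cbox u v \<and> cbox u v \<subseteq> ball t0 d \<and> cbox u v \<subseteq> cbox a b \<longrightarrow>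
          (\<lambda>t. \<psi> t * g t) integrable_on cbox u v" for t0 a b
  proof -
    obtain d \<Phi> where d: "0 < d" "continuous_on (ball t0 d) \<Phi>"
      "\<And>t g. t \<in> ball t0 d \<Longrightarrow> (\<gamma> has_vector_derivative g) (at t) \<Longrightarrow> (\<Phi> has_vector_derivative \<psi> t * g) (at t)"
      using power_germ_local_primitive[OF germ cont vals] by blast
    have "(\<lambda>t. \<psi> t * g t) integrable_on cbox u v" if uv: "t0 \<in> cbox u v" "cbox u v \<subseteq> ball t0 d" for u v
    proof (cases "u < v")
      case True
      obtain S where S: "finite S" "\<forall>t\<in>{u<..<v} - S. (\<gamma> has_vector_derivative g t) (at t)"
        using deriv[OF True] by blast
      have "((\<lambda>t. \<psi> t * g t) has_integral \<Phi> v - \<Phi> u) {u..v}"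
      proof (rule fundamental_theorem_of_calculus_interior_strong[OF S(1)])
        show "(\<Phi> has_vector_derivative \<psi> t * g t) (at t)" if "t \<in> {u<..<v} - S" for t
        proof (rule d(3))
          have "t \<in> cbox u v"
            using that by simp
          then show "t \<in> ball t0 d"
            using uv by blast
        qed (use S that in auto)
        show "continuous_on {u..v} \<Phi>"
          using continuous_on_subset[OF d(2)] uv(2) by simp
      qed (use True in simp)
      then show ?thesis
        by (auto simp: integrable_on_def)
    next
      case False
      then show ?thesis
        using uv(1) integrable_on_refl[of "\<lambda>t. \<psi> t * g t" t0] by (cases "u = v") auto
    qed
    with d(1) show ?thesis
      by blast
  qed
  then have "(\<lambda>t. \<psi> t * g t) integrable_on cbox u v"
    by (intro integrable_on_little_subintervals) blast
  then show ?thesis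
    by simp
qed

section \<open>Growth of the Gamma factors\<close>

lemma ln_Gamma_real_plus1:
  assumes "0 < (x::real)"
  shows "ln_Gamma (x + 1) = ln x + ln_Gamma x"
proof -
  have "x \<notin> \<int>\<^sub>\<le>\<^sub>0"
    using assms by (auto elim!: nonpos_Ints_cases')
  then have "Gamma (x + 1) = x * Gamma x"
    by (simp add: Gamma_plus1)
  then show ?thesis
    using assms by (simp add: ln_Gamma_real_pos ln_mult_pos)
qed

text \<open>The increment of \<open>ln_Gamma\<close> over [x, x + 1] is ln x. By the mean value
  theorem it is a value of Digamma to the right of x, and Digamma is increasing. The interval
  [x - 1, x] gives the lower bound in the same way.\<close>

lemma Digamma_real_le_ln:
  assumes "0 < (x::real)"
  shows "Digamma x \<le> ln x"
proof -
  have "\<exists>\<xi>>x. \<xi> < x + 1 \<and> ln_Gamma (x + 1) - ln_Gamma x = (x + 1 - x) * Digamma \<xi>"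
    using assms by (intro MVT2) (auto intro!: derivative_eq_intros)
  then obtain \<xi> where \<xi>: "x < \<xi>" "ln_Gamma (x + 1) - ln_Gamma x = Digamma \<xi>"
    by auto
  then show ?thesis
    using ln_Gamma_real_plus1[OF assms] Digamma_real_mono[of x \<xi>] assms by simp
qed

lemma ln_minus_one_le_Digamma_real:
  assumes "1 < (x::real)"
  shows "ln (x - 1) \<le> Digamma x"
proof -
  have "\<exists>\<xi>>x - 1. \<xi> < x \<and> ln_Gamma x - ln_Gamma (x - 1) = (x - (x - 1)) * Digamma \<xi>"
    using assms by (intro MVT2) (auto intro!: derivative_eq_intros)
  then obtain \<xi> where \<xi>: "x - 1 < \<xi>" "\<xi> < x" "ln_Gamma x - ln_Gamma (x - 1) = Digamma \<xi>"
    by auto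
  then show ?thesis
    using ln_Gamma_real_plus1[of "x - 1"] Digamma_real_mono[of \<xi> x] assms by simp
qed

text \<open>Since Digamma \<le> ln, \<open>ln_Gamma\<close> minus the primitive u ln u - u of ln is
  nonincreasing; its value 1 at u = 1 is the constant.\<close>

lemma ln_Gamma_real_upper:
  assumes "1 \<le> (u::real)"
  shows "ln_Gamma u \<le> u * ln u - u + 1"
proof -
  have "ln_Gamma u - (u * ln u - u) \<le> ln_Gamma 1 - (1 * ln 1 - 1)"
  proof (rule DERIV_nonpos_imp_nonincreasing[OF assms])
    fix x :: real assume "1 \<le> x" "x \<le> u"
    then have "((\<lambda>u. ln_Gamma u - (u * ln u - u)) has_field_derivative (Digamma x - ln x)) (at x)"
      by (auto intro!: derivative_eq_intros)
    then show "\<exists>y. ((\<lambda>u. ln_Gamma u - (u * ln u - u)) has_field_derivative y) (at x) \<and> y \<le> 0"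
      using Digamma_real_le_ln[of x] \<open>1 \<le> x\<close> by (intro exI conjI) auto
  qed
  then show ?thesis
    by (simp add: ln_Gamma_real_pos)
qed

text \<open>Now the difference from the shifted primitive is nondecreasing, starting with the value
  1 at u = 2. The shift by 1 costs only O(ln u), negligible against the linear term.\<close>

lemma ln_Gamma_real_lower:
  assumes "2 \<le> (u::real)"
  shows "(u - 1) * ln (u - 1) - (u - 1) + 1 \<le> ln_Gamma u"
proof -
  have "ln_Gamma 2 - ((2 - 1) * ln (2 - 1) - (2 - 1)) \<le> ln_Gamma u - ((u - 1) * ln (u - 1) - (u - 1))"
  proof (rule DERIV_nonneg_imp_nondecreasing[OF assms])
    fix x :: real assume "2 \<le> x" "x \<le> u"
    then have "((\<lambda>u. ln_Gamma u - ((u - 1) * ln (u - 1) - (u - 1))) has_field_derivative (Digamma x - ln (x - 1))) (at x)"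
      by (auto intro!: derivative_eq_intros)
    then show "\<exists>y. ((\<lambda>u. ln_Gamma u - ((u - 1) * ln (u - 1) - (u - 1))) has_field_derivative y) (at x) \<and> 0 \<le> y"
      using ln_minus_one_le_Digamma_real[of x] \<open>2 \<le> x\<close> by (intro exI conjI) auto
  qed
  moreover have "ln_Gamma (2::real) = 0"
    using Gamma_numeral[of "num.Bit0 num.One", where 'a = real] by (simp add: ln_Gamma_real_pos)
  ultimately show ?thesis
    by simp
qed

text \<open>In Euler's integral, t^(w-1) has modulus t^(Re w - 1) for t > 0.\<close>

lemma norm_Gamma_le_Gamma_Re:
  assumes "0 < Re w"
  shows "norm (Gamma w) \<le> Gamma (Re w)"
proof -
  let ?f = "\<lambda>t. complex_of_real t powr (w - 1) / of_real (exp t)"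
  let ?g = "\<lambda>t. t powr (Re w - 1) / exp t"
  have f: "(?f has_integral Gamma w) {0..}" and g: "(?g has_integral Gamma (Re w)) {0..}"
    using Gamma_integral_complex[OF assms] Gamma_integral_real[OF assms] .
  have "norm (integral {0..} ?f) \<le> integral {0..} ?g"
  proof (rule Henstock_Kurzweil_Integration.integral_norm_bound_integral)
    show "norm (?f t) \<le> ?g t" if "t \<in> {0..}" for t
      using that by (simp add: norm_divide norm_powr_real_powr)
  qed (use f g in \<open>auto simp: integrable_on_def\<close>)
  then show ?thesis
    using f g by (simp add: integral_unique)
qed

text \<open>The functional equation moves w to w0 with real part in [1, 2]. The Pochhammer product
  that arises is in modulus at least the one for Re w0, which turns Gamma(Re w0) into Gamma(Re w).
  Compactness bounds what remains.\<close>

lemma norm_rGamma_le_in_strip: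
  "\<exists>C>0. \<forall>w. 1 \<le> Re w \<and> \<bar>Im w\<bar> \<le> Y \<longrightarrow> norm (rGamma w) \<le> C / Gamma (Re w)"
proof -
  have "compact (rGamma ` cbox (Complex 1 (-Y)) (Complex 2 Y))"
    by (intro compact_continuous_image continuous_on_rGamma compact_cbox)
  from compact_imp_bounded[OF this, unfolded bounded_pos ball_simps]
  obtain M where M: "0 < M" "\<forall>w\<in>cbox (Complex 1 (-Y)) (Complex 2 Y). norm (rGamma w) \<le> M"
    by blast
  have "compact (Gamma ` {1..2::real})"
    by (intro compact_continuous_image continuous_on_Gamma) (auto elim!: nonpos_Ints_cases')
  from compact_imp_bounded[OF this, unfolded bounded_pos ball_simps]
  obtain M' where M': "0 < M'" "\<forall>u\<in>{1..2::real}. norm (Gamma u) \<le> M'"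
    by blast
  have "norm (rGamma w) \<le> M * M' / Gamma (Re w)" if w: "1 \<le> Re w" "\<bar>Im w\<bar> \<le> Y" for w
  proof -
    define N where "N = nat (\<lfloor>Re w\<rfloor> - 1)"
    define w0 where "w0 = w - of_nat N"
    have "1 \<le> \<lfloor>Re w\<rfloor>"
      using w by simp
    then have N: "real N = of_int \<lfloor>Re w\<rfloor> - 1"
      by (simp add: N_def)
    have w0: "1 \<le> Re w0" "Re w0 \<le> 2" "Im w0 = Im w"
      using of_int_floor_le[of "Re w"] floor_correct[of "Re w"] by (auto simp: w0_def N, linarith)
    have "pochhammer (Re w0) N = Gamma (Re w) / Gamma (Re w0)"
      using w0 by (subst pochhammer_Gamma) (auto elim!: nonpos_Ints_cases' simp: w0_def)
    then have poch: "Gamma (Re w) = pochhammer (Re w0) N * Gamma (Re w0)"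
      using w0(1) less_imp_neq[OF Gamma_real_pos[of "Re w0"]] by simp
    have "norm (rGamma w) * pochhammer (Re w0) N \<le> norm (rGamma w) * norm (pochhammer w0 N)"
    proof (rule mult_left_mono)
      have "pochhammer (Re w0) N = (\<Prod>i=0..<N. Re (w0 + of_nat i))"
        by (simp add: pochhammer_prod)
      also have "\<dots> \<le> (\<Prod>i=0..<N. norm (w0 + of_nat i))"
        using w0(1) by (intro prod_mono conjI complex_Re_le_cmod) simp
      also have "\<dots> = norm (pochhammer w0 N)"
        by (simp add: pochhammer_prod prod_norm)
      finally show "pochhammer (Re w0) N \<le> norm (pochhammer w0 N)" .
    qed simp
    also have "\<dots> = norm (rGamma w0)"
      using pochhammer_rGamma[of w0 N] by (simp add: w0_def norm_mult mult.commute)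
    also have "\<dots> \<le> M"
      using w0 w by (intro M(2)[rule_format]) (auto simp: cbox_complex_eq)
    finally have "norm (rGamma w) * pochhammer (Re w0) N * Gamma (Re w0) \<le> M * M'"
      using M'(2)[rule_format, of "Re w0"] w0 M(1) Gamma_real_pos[of "Re w0"] by (intro mult_mono) auto
    then show ?thesis
      using w Gamma_real_pos[of "Re w"] by (simp add: poch field_simps)
  qed
  then show ?thesis
    using M(1) M'(1) by (intro exI[of _ "M * M'"]) auto
qed

lemma norm_sin_le_exp: "norm (sin (z::complex)) \<le> exp \<bar>Im z\<bar>"
proof -
  have "norm (sin z) = norm (exp (\<i> * z) - exp (- (\<i> * z))) / 2"
    by (simp add: sin_exp_eq norm_divide norm_mult)
  also have "\<dots> \<le> (exp (- Im z) + exp (Im z)) / 2"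
    using norm_triangle_ineq4[of "exp (\<i> * z)" "exp (- (\<i> * z))"] by simp
  also have "\<dots> \<le> (exp \<bar>Im z\<bar> + exp \<bar>Im z\<bar>) / 2"
    by (intro divide_right_mono add_mono) auto
  finally show ?thesis
    by simp
qed

text \<open>The modulus of sin(\<pi> w) has period 1, so a rectangle of width 1 suffices. Its points
  at distance at least \<delta> from all integers form a compact set without zeros of the
  sine.\<close>

lemma norm_sin_pi_ge_away_from_Ints:
  assumes "0 < \<delta>"
  shows "\<exists>c>0. \<forall>w. \<bar>Im w\<bar> \<le> Y \<and> (\<forall>k::int. \<delta> \<le> norm (w - of_int k)) \<longrightarrow> c \<le> norm (sin (of_real pi * w))"
proof -
  define K where "K = cbox (Complex 0 (-Y)) (Complex 1 Y) \<inter> (\<Inter>k::int. {w. \<delta> \<le> norm (w - of_int k)})"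
  have "closed (\<Inter>k::int. {w::complex. \<delta> \<le> norm (w - of_int k)})"
    by (intro closed_INT ballI closed_Collect_le continuous_intros)
  then have "compact K"
    unfolding K_def by (intro compact_Int_closed compact_cbox)
  have nz: "sin (of_real pi * w) \<noteq> 0" if "w \<in> K" for w
  proof
    assume "sin (of_real pi * w) = 0"
    then obtain n :: int where "of_real pi * w = of_real (of_int n * pi)"
      by (auto simp: sin_eq_0)
    then have "of_real pi * (w - of_int n) = 0"
      by (simp add: algebra_simps)
    then have "w = of_int n"
      by simp
    moreover have "\<delta> \<le> norm (w - of_int n)"
      using that by (auto simp: K_def)
    ultimately show False
      using assms by simp
  qed
  have "\<exists>c>0. \<forall>w\<in>K. c \<le> norm (sin (of_real pi * w))"
  proof (cases "K = {}")
    case False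
    have "continuous_on K (\<lambda>w. norm (sin (of_real pi * w)))"
      by (intro continuous_intros)
    from continuous_attains_inf[OF \<open>compact K\<close> False this]
    obtain w0 where "w0 \<in> K" "\<forall>w\<in>K. norm (sin (of_real pi * w0)) \<le> norm (sin (of_real pi * w))"
      by blast
    then show ?thesis
      using nz by (intro exI[of _ "norm (sin (of_real pi * w0))"]) auto
  qed (auto intro: exI[of _ 1])
  then obtain c where c: "0 < c" "\<And>w. w \<in> K \<Longrightarrow> c \<le> norm (sin (of_real pi * w))"
    by blast
  have "c \<le> norm (sin (of_real pi * w))" if w: "\<bar>Im w\<bar> \<le> Y" "\<And>k::int. \<delta> \<le> norm (w - of_int k)" for w
  proof -
    define n where "n = \<lfloor>Re w\<rfloor>"
    have "\<delta> \<le> norm (w - of_int n - of_int k)" for k :: int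
      using w(2)[of "n + k"] by (simp add: algebra_simps)
    moreover have "w - of_int n \<in> cbox (Complex 0 (-Y)) (Complex 1 Y)"
      using w(1) of_int_floor_le[of "Re w"] floor_correct[of "Re w"] by (auto simp: cbox_complex_eq n_def, linarith)
    ultimately have "c \<le> norm (sin (of_real pi * (w - of_int n)))"
      by (intro c(2)) (auto simp: K_def)
    also have "of_real pi * (w - of_int n) = of_real pi * w - of_real (of_int n * pi)"
      by (simp add: algebra_simps)
    also have "norm (sin \<dots>) = norm (sin (of_real pi * w))"
    proof -
      have "sin (complex_of_real (of_int n * pi)) = 0"
        by (auto simp: sin_eq_0)
      moreover have "norm (cos (complex_of_real (of_int n * pi))) = 1"
      proof -
        have "\<bar>cos (of_int n * pi)\<bar> = 1"
          by (simp add: mult.commute[of _ pi])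
        then show ?thesis
          by (simp only: cos_of_real norm_of_real)
      qed
      ultimately show ?thesis
        by (simp only: sin_diff) (simp add: norm_mult)
    qed
    finally show ?thesis .
  qed
  with c(1) show ?thesis
    by blast
qed

text \<open>Replacing r + \<beta> x by \<beta> x changes the Stirling exponent by O(ln x) only. The
  absolute value lets one statement serve for both Gamma and its reciprocal.\<close>

lemma stirling_shift_asymptotics:
  fixes \<beta> r C \<epsilon> :: real
  assumes "0 < \<beta>" "0 < \<epsilon>"
  shows "\<forall>\<^sub>F x in at_top. \<bar>(r + \<beta> * x) * ln (r + \<beta> * x) - (r + \<beta> * x) + C
           - (\<beta> * (x * ln x) + (\<beta> * ln \<beta> - \<beta>) * x)\<bar> \<le> \<epsilon> * x"
proof -
  have "((\<lambda>x. ((r + \<beta> * x) * ln (r + \<beta> * x) - (r + \<beta> * x) + C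
           - (\<beta> * (x * ln x) + (\<beta> * ln \<beta> - \<beta>) * x)) / x) \<longlongrightarrow> 0) at_top"
    using assms(1) by real_asymp
  from tendstoD[OF this assms(2)] eventually_gt_at_top[of 0] show ?thesis
    by eventually_elim (simp add: dist_norm abs_divide divide_less_eq)
qed

text \<open>With x = -Re s, this is the exponent \<mu> x ln x + (\<kappa> + o(1)) x, uniformly in
  all values of the branches. Both coefficients add under products; the \<epsilon> absorbs bounded
  factors and powers of x.\<close>

definition growth_le :: "complex filter \<Rightarrow> (complex \<Rightarrow> complex set) \<Rightarrow> real \<Rightarrow> real \<Rightarrow> bool" where
  "growth_le F V \<mu> \<kappa> \<longleftrightarrow>
     (\<forall>\<epsilon>>0. \<forall>\<^sub>F s in F. \<forall>v\<in>V s. norm v \<le> exp (\<mu> * (- Re s * ln (- Re s)) + (\<kappa> + \<epsilon>) * (- Re s)))"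

lemma growth_le_mult:
  assumes "growth_le F V \<mu> \<kappa>" "growth_le F W \<mu>' \<kappa>'"
  shows "growth_le F (\<lambda>s. V s * W s) (\<mu> + \<mu>') (\<kappa> + \<kappa>')"
  unfolding growth_le_def
proof (intro allI impI)
  fix \<epsilon> :: real assume "\<epsilon> > 0"
  then have "\<epsilon> / 2 > 0"
    by simp
  from assms[unfolded growth_le_def, rule_format, OF this]
  show "\<forall>\<^sub>F s in F. \<forall>v\<in>V s * W s.
      norm v \<le> exp ((\<mu> + \<mu>') * (- Re s * ln (- Re s)) + (\<kappa> + \<kappa>' + \<epsilon>) * (- Re s))"
  proof eventually_elim
    case (elim s)
    have "norm (v * w) \<le> exp ((\<mu> + \<mu>') * (- Re s * ln (- Re s)) + (\<kappa> + \<kappa>' + \<epsilon>) * (- Re s))"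
      if "v \<in> V s" "w \<in> W s" for v w
    proof -
      have "norm (v * w) \<le> exp (\<mu> * (- Re s * ln (- Re s)) + (\<kappa> + \<epsilon> / 2) * (- Re s)) *
                          exp (\<mu>' * (- Re s * ln (- Re s)) + (\<kappa>' + \<epsilon> / 2) * (- Re s))"
        unfolding norm_mult using elim that by (intro mult_mono) auto
      also have "\<dots> = exp ((\<mu> + \<mu>') * (- Re s * ln (- Re s)) + (\<kappa> + \<kappa>' + \<epsilon>) * (- Re s))"
        unfolding exp_add[symmetric] by (simp add: algebra_simps)
      finally show ?thesis .
    qed
    then show ?case
      by (auto elim!: set_times_elim)
  qed
qed

lemma growth_le_subset:
  assumes "growth_le F W \<mu> \<kappa>" "\<forall>\<^sub>F s in F. V s \<subseteq> W s"
  shows "growth_le F V \<mu> \<kappa>"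
  unfolding growth_le_def
proof (intro allI impI)
  fix \<epsilon> :: real assume "\<epsilon> > 0"
  from assms(1)[unfolded growth_le_def, rule_format, OF this] assms(2)
  show "\<forall>\<^sub>F s in F. \<forall>v\<in>V s. norm v \<le> exp (\<mu> * (- Re s * ln (- Re s)) + (\<kappa> + \<epsilon>) * (- Re s))"
    by eventually_elim blast
qed

text \<open>As c is real, every nonzero value has modulus |G|^c, whichever logarithm is taken; so
  the exponent is multiplied by c.\<close>

lemma growth_le_power_values:
  assumes "growth_le F (\<lambda>s. {G s}) \<mu> \<kappa>" "0 < c"
  shows "growth_le F (\<lambda>s. power_values (G s) c) (c * \<mu>) (c * \<kappa>)"
  unfolding growth_le_def
proof (intro allI impI)
  fix \<epsilon> :: real assume "\<epsilon> > 0"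
  then have "\<epsilon> / c > 0"
    using assms(2) by simp
  from assms(1)[unfolded growth_le_def, rule_format, OF this]
  show "\<forall>\<^sub>F s in F. \<forall>v\<in>power_values (G s) c.
          norm v \<le> exp (c * \<mu> * (- Re s * ln (- Re s)) + (c * \<kappa> + \<epsilon>) * (- Re s))"
  proof eventually_elim
    case (elim s)
    define X where "X = \<mu> * (- Re s * ln (- Re s)) + (\<kappa> + \<epsilon> / c) * (- Re s)"
    have X: "c * X = c * \<mu> * (- Re s * ln (- Re s)) + (c * \<kappa> + \<epsilon>) * (- Re s)"
      using assms(2) by (simp add: X_def field_simps)
    have "norm v \<le> exp (c * X)" if v: "v \<in> power_values (G s) c" for v
    proof (cases "G s = 0")
      case False
      then obtain l where l: "v = exp (of_real c * l)" "exp l = G s"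
        using v by (auto simp: power_values_def)
      have "exp (Re l) = norm (G s)"
        using l(2) norm_exp_eq_Re[of l] by simp
      also have "\<dots> \<le> exp X"
        using elim by (simp add: X_def)
      finally show ?thesis
        using assms(2) by (simp add: l(1))
    qed (use v in \<open>simp add: power_values_def\<close>)
    then show ?case
      by (simp add: X)
  qed
qed

section \<open>Growth of single factors far to the left in a horizontal strip\<close>

context
  fixes F :: "complex filter" and Y :: real
  assumes left: "filterlim Re at_bot F" and strip: "\<forall>\<^sub>F s in F. \<bar>Im s\<bar> \<le> Y"
begin

lemma eventually_minus_Re:
  assumes "\<forall>\<^sub>F x in at_top. P x"
  shows "\<forall>\<^sub>F s in F. P (- Re s)"
  using filterlim_compose[OF filterlim_uminus_at_top_at_bot left] assms
  by (simp add: filterlim_iff)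

lemma growth_le_bounded:
  assumes "\<forall>\<^sub>F s in F. \<forall>v\<in>V s. norm v \<le> M"
  shows "growth_le F V 0 0"
  unfolding growth_le_def
proof (intro allI impI)
  fix \<epsilon> :: real assume "\<epsilon> > 0"
  then have "\<forall>\<^sub>F x in at_top. M \<le> exp (\<epsilon> * x)"
    by real_asymp
  from eventually_minus_Re[OF this] assms
  show "\<forall>\<^sub>F s in F. \<forall>v\<in>V s. norm v \<le> exp (0 * (- Re s * ln (- Re s)) + (0 + \<epsilon>) * (- Re s))"
    by eventually_elim (auto intro: order_trans)
qed

text \<open>The modulus is |c| exp(Re s Re d - Im s Im d), and in the strip the second term of the
  exponent is bounded.\<close>

lemma growth_le_exp: "growth_le F (\<lambda>s. {c * exp (s * d)}) 0 (- Re d)"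
  unfolding growth_le_def
proof (intro allI impI)
  fix \<epsilon> :: real assume "\<epsilon> > 0"
  then have "\<forall>\<^sub>F x in at_top. norm c * exp (Y * \<bar>Im d\<bar>) \<le> exp (\<epsilon> * x)"
    by real_asymp
  from eventually_minus_Re[OF this] strip
  show "\<forall>\<^sub>F s in F. \<forall>v\<in>{c * exp (s * d)}. norm v \<le> exp (0 * (- Re s * ln (- Re s)) + (- Re d + \<epsilon>) * (- Re s))"
  proof eventually_elim
    case (elim s)
    have "- (Im s * Im d) \<le> \<bar>Im s\<bar> * \<bar>Im d\<bar>"
      using abs_ge_minus_self[of "Im s * Im d"] by (simp add: abs_mult)
    also have "\<dots> \<le> Y * \<bar>Im d\<bar>"
      using elim by (intro mult_right_mono) auto
    finally have "norm c * exp (Re s * Re d - Im s * Im d) \<le> norm c * (exp (Re s * Re d) * exp (Y * \<bar>Im d\<bar>))"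
      unfolding exp_add[symmetric] by (intro mult_left_mono) auto
    also have "\<dots> = (norm c * exp (Y * \<bar>Im d\<bar>)) * exp (Re s * Re d)"
      by simp
    also have "\<dots> \<le> exp (\<epsilon> * (- Re s)) * exp (Re s * Re d)"
      using elim by (intro mult_right_mono) auto
    also have "\<dots> = exp ((- Re d + \<epsilon>) * (- Re s))"
      unfolding exp_add[symmetric] by (simp add: algebra_simps)
    finally show ?case
      by (simp add: norm_mult)
  qed
qed

lemma growth_le_prod:
  assumes "\<And>j. j \<in> J \<Longrightarrow> growth_le F (V j) (\<mu> j) (\<kappa> j)"
  shows "growth_le F (\<lambda>s. \<Prod>j\<in>J. V j s) (\<Sum>j\<in>J. \<mu> j) (\<Sum>j\<in>J. \<kappa> j)"
proof (cases "finite J")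
  case True
  then show ?thesis
    using assms
  proof (induction J)
    case empty
    show ?case
      by (simp add: growth_le_bounded[of _ 1])
  qed (simp add: growth_le_mult)
qed (simp add: growth_le_bounded[of _ 1])

context
  fixes c :: complex and \<beta> :: real
  assumes \<beta>: "0 < \<beta>"
begin

lemma eventually_Re_affine_ge: "\<forall>\<^sub>F s in F. M \<le> Re (c - of_real \<beta> * s)"
proof -
  have "\<forall>\<^sub>F x in at_top. M \<le> Re c + \<beta> * x"
    using \<beta> by real_asymp
  from eventually_minus_Re[OF this] show ?thesis
    by simp
qed

lemma growth_le_Gamma: "growth_le F (\<lambda>s. {Gamma (c - of_real \<beta> * s)}) \<beta> (\<beta> * (ln \<beta> - 1))"
  unfolding growth_le_def
proof (intro allI impI)
  fix \<epsilon> :: real assume "\<epsilon> > 0"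
  from eventually_minus_Re[OF stirling_shift_asymptotics[OF \<beta> this, of "Re c" 1]] eventually_Re_affine_ge[of 1]
  show "\<forall>\<^sub>F s in F. \<forall>v\<in>{Gamma (c - of_real \<beta> * s)}.
          norm v \<le> exp (\<beta> * (- Re s * ln (- Re s)) + (\<beta> * (ln \<beta> - 1) + \<epsilon>) * (- Re s))"
  proof eventually_elim
    case (elim s)
    define u where "u = Re (c - of_real \<beta> * s)"
    have u: "u = Re c + \<beta> * (- Re s)" "1 \<le> u"
      using elim by (simp_all add: u_def)
    have "norm (Gamma (c - of_real \<beta> * s)) \<le> exp (ln_Gamma u)"
      using norm_Gamma_le_Gamma_Re[of "c - of_real \<beta> * s"] u(2) by (simp add: u_def Gamma_real_pos_exp)
    also have "\<dots> \<le> exp (u * ln u - u + 1)"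
      using ln_Gamma_real_upper[OF u(2)] by simp
    also have "\<dots> \<le> exp (\<beta> * (- Re s * ln (- Re s)) + (\<beta> * (ln \<beta> - 1) + \<epsilon>) * (- Re s))"
      using elim(1)[THEN abs_le_D1] unfolding u(1) by (simp add: algebra_simps)
    finally show ?case
      by simp
  qed
qed

lemma growth_le_rGamma: "growth_le F (\<lambda>s. {rGamma (c - of_real \<beta> * s)}) (- \<beta>) (- (\<beta> * (ln \<beta> - 1)))"
  unfolding growth_le_def
proof (intro allI impI)
  obtain C where C: "0 < C" "\<And>w. 1 \<le> Re w \<Longrightarrow> \<bar>Im w\<bar> \<le> \<bar>Im c\<bar> + \<beta> * Y \<Longrightarrow> norm (rGamma w) \<le> C / Gamma (Re w)"
    using norm_rGamma_le_in_strip[of "\<bar>Im c\<bar> + \<beta> * Y"] by blast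
  fix \<epsilon> :: real assume "\<epsilon> > 0"
  \<comment> \<open>The shift by -1 and the constant 1 come from \<open>ln_Gamma_real_lower\<close>;
    -ln C accounts for the factor C of the strip bound.\<close>
  from eventually_minus_Re[OF stirling_shift_asymptotics[OF \<beta> this, of "Re c - 1" "1 - ln C"]] eventually_Re_affine_ge[of 2] strip
  show "\<forall>\<^sub>F s in F. \<forall>v\<in>{rGamma (c - of_real \<beta> * s)}.
          norm v \<le> exp (- \<beta> * (- Re s * ln (- Re s)) + (- (\<beta> * (ln \<beta> - 1)) + \<epsilon>) * (- Re s))"
  proof eventually_elim
    case (elim s)
    define u where "u = Re (c - of_real \<beta> * s)"
    have u: "u = Re c + \<beta> * (- Re s)" "2 \<le> u"
      using elim by (simp_all add: u_def)
    have "\<bar>Im (c - of_real \<beta> * s)\<bar> \<le> \<bar>Im c\<bar> + \<beta> * \<bar>Im s\<bar>"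
      using abs_triangle_ineq4[of "Im c" "\<beta> * Im s"] \<beta> by (simp add: abs_mult)
    also have "\<dots> \<le> \<bar>Im c\<bar> + \<beta> * Y"
      using elim \<beta> by simp
    finally have "norm (rGamma (c - of_real \<beta> * s)) \<le> C / Gamma u"
      using C(2)[of "c - of_real \<beta> * s"] u(2) by (simp add: u_def)
    also have "\<dots> = exp (ln C - ln_Gamma u)"
      using C(1) u(2) by (simp add: exp_diff Gamma_real_pos_exp)
    also have "\<dots> \<le> exp (ln C - ((u - 1) * ln (u - 1) - (u - 1) + 1))"
      using ln_Gamma_real_lower[OF u(2)] by simp
    also have "\<dots> \<le> exp (- \<beta> * (- Re s * ln (- Re s)) + (- (\<beta> * (ln \<beta> - 1)) + \<epsilon>) * (- Re s))"
      using elim(1)[THEN abs_le_D2] unfolding u(1) by (simp add: algebra_simps)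
    finally show ?case
      by simp
  qed
qed

text \<open>The argument 1 - w, with w = c - \<beta> s, runs to the left. Reflection gives rGamma(1
  - w) = Gamma(w) sin(\<pi> w)/\<pi>, and the sine is bounded in the strip.\<close>

lemma growth_le_rGamma_reflected:
  "growth_le F (\<lambda>s. {rGamma (1 - c + of_real \<beta> * s)}) \<beta> (\<beta> * (ln \<beta> - 1))"
proof -
  let ?w = "\<lambda>s. c - of_real \<beta> * s"
  have "growth_le F (\<lambda>s. {sin (of_real pi * ?w s) / of_real pi}) 0 0"
  proof (rule growth_le_bounded)
    show "\<forall>\<^sub>F s in F. \<forall>v\<in>{sin (of_real pi * ?w s) / of_real pi}. norm v \<le> exp (pi * (\<bar>Im c\<bar> + \<beta> * Y)) / pi"
      using strip
    proof eventually_elim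
      case (elim s)
      have "\<bar>Im (?w s)\<bar> \<le> \<bar>Im c\<bar> + \<beta> * \<bar>Im s\<bar>"
        using abs_triangle_ineq4[of "Im c" "\<beta> * Im s"] \<beta> by (simp add: abs_mult)
      also have "\<dots> \<le> \<bar>Im c\<bar> + \<beta> * Y"
        using elim \<beta> by simp
      finally have "norm (sin (of_real pi * ?w s)) \<le> exp (pi * (\<bar>Im c\<bar> + \<beta> * Y))"
        by (intro order_trans[OF norm_sin_le_exp]) (simp add: abs_mult)
      then show ?case
        by (simp add: norm_divide divide_right_mono)
    qed
  qed
  from growth_le_mult[OF growth_le_Gamma this]
  have "growth_le F (\<lambda>s. {Gamma (?w s)} * {sin (of_real pi * ?w s) / of_real pi}) \<beta> (\<beta> * (ln \<beta> - 1))"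
    by simp
  then show ?thesis
  proof (rule growth_le_subset)
    show "\<forall>\<^sub>F s in F. {rGamma (1 - c + of_real \<beta> * s)} \<subseteq> {Gamma (?w s)} * {sin (of_real pi * ?w s) / of_real pi}"
      using eventually_Re_affine_ge[of 1]
    proof eventually_elim
      case (elim s)
      have "?w s \<notin> \<int>\<^sub>\<le>\<^sub>0"
        using elim by (auto elim!: nonpos_Ints_cases' simp: complex_eq_iff)
      then have "Gamma (?w s) * rGamma (?w s) = 1"
        by (simp add: rGamma_inverse_Gamma Gamma_eq_zero_iff)
      then have "rGamma (1 - ?w s) = Gamma (?w s) * (rGamma (?w s) * rGamma (1 - ?w s))"
        by (metis mult.assoc mult_1)
      also have "\<dots> = Gamma (?w s) * (sin (of_real pi * ?w s) / of_real pi)"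
        by (simp only: rGamma_reflection_complex)
      finally show ?case
        by (auto simp: set_times_def algebra_simps)
    qed
  qed
qed

text \<open>Reflection now puts sin(\<pi> w) into the denominator, so it must stay away from 0; this
  is what the distance \<delta> from the poles provides.\<close>

lemma growth_le_Gamma_reflected:
  assumes \<delta>: "0 < \<delta>" "\<forall>\<^sub>F s in F. \<forall>w. 1 - c + of_real \<beta> * w \<in> \<int>\<^sub>\<le>\<^sub>0 \<longrightarrow> \<delta> \<le> dist s w"
  shows "growth_le F (\<lambda>s. {Gamma (1 - c + of_real \<beta> * s)}) (- \<beta>) (- (\<beta> * (ln \<beta> - 1)))"
proof -
  let ?w = "\<lambda>s. c - of_real \<beta> * s"
  have "0 < \<beta> * \<delta>"
    using \<beta> \<delta> by simp
  then obtain C where C: "0 < C" "\<And>w. \<bar>Im w\<bar> \<le> \<bar>Im c\<bar> + \<beta> * Y \<Longrightarrow> (\<forall>k::int. \<beta> * \<delta> \<le> norm (w - of_int k)) \<Longrightarrow>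
      C \<le> norm (sin (of_real pi * w))"
    using norm_sin_pi_ge_away_from_Ints[of "\<beta> * \<delta>" "\<bar>Im c\<bar> + \<beta> * Y"] by blast
  have ev: "\<forall>\<^sub>F s in F. C \<le> norm (sin (of_real pi * ?w s))"
    using strip \<delta>(2) eventually_Re_affine_ge[of "\<beta> * \<delta> + 1"]
  proof eventually_elim
    case (elim s)
    have "\<bar>Im (?w s)\<bar> \<le> \<bar>Im c\<bar> + \<beta> * \<bar>Im s\<bar>"
      using abs_triangle_ineq4[of "Im c" "\<beta> * Im s"] \<beta> by (simp add: abs_mult)
    also have "\<dots> \<le> \<bar>Im c\<bar> + \<beta> * Y"
      using elim \<beta> by simp
    finally have im: "\<bar>Im (?w s)\<bar> \<le> \<bar>Im c\<bar> + \<beta> * Y" .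
    \<comment> \<open>The integers k \<ge> 1 are the poles of Gamma(1 - w); the map from s to w
      scales distances by \<beta>. The integers k \<le> 0 are far away because Re w is eventually at
      least \<beta> \<delta> + 1.\<close>
    have "\<beta> * \<delta> \<le> norm (?w s - of_int k)" for k :: int
    proof (cases "k \<ge> 1")
      case True
      define s' where "s' = (c - of_int k) / of_real \<beta>"
      have s': "of_real \<beta> * s' = c - of_int k"
        using \<beta> by (simp add: s'_def)
      have "1 - c + of_real \<beta> * s' = of_int (1 - k)"
        by (simp add: s')
      also have "\<dots> \<in> \<int>\<^sub>\<le>\<^sub>0"
        using True by (intro nonpos_Ints_of_int) simp
      finally have "\<delta> \<le> dist s s'"
        using elim by blast
      moreover have "?w s - of_int k = of_real \<beta> * (s' - s)"
        by (simp add: right_diff_distrib s')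
      ultimately show ?thesis
        using \<beta> by (simp add: norm_mult dist_norm norm_minus_commute)
    next
      case False
      then have "real_of_int k \<le> 0"
        by simp
      then have "\<beta> * \<delta> \<le> Re (?w s - of_int k)"
        using elim by simp
      then show ?thesis
        using complex_Re_le_cmod order_trans by blast
    qed
    then show ?case
      using C(2) im by blast
  qed
  have "growth_le F (\<lambda>s. {of_real pi / sin (of_real pi * ?w s)}) 0 0"
  proof (rule growth_le_bounded)
    show "\<forall>\<^sub>F s in F. \<forall>v\<in>{of_real pi / sin (of_real pi * ?w s)}. norm v \<le> pi / C"
      using ev by eventually_elim (use C(1) in \<open>auto simp: norm_divide intro!: divide_left_mono mult_pos_pos\<close>)
  qed
  from growth_le_mult[OF growth_le_rGamma this]
  have "growth_le F (\<lambda>s. {rGamma (?w s)} * {of_real pi / sin (of_real pi * ?w s)}) (- \<beta>) (- (\<beta> * (ln \<beta> - 1)))"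
    by simp
  then show ?thesis
  proof (rule growth_le_subset)
    show "\<forall>\<^sub>F s in F. {Gamma (1 - c + of_real \<beta> * s)} \<subseteq> {rGamma (?w s)} * {of_real pi / sin (of_real pi * ?w s)}"
      using ev
    proof eventually_elim
      case (elim s)
      then have nz: "sin (of_real pi * ?w s) \<noteq> 0"
        using C(1) by auto
      have eq: "rGamma (?w s) * rGamma (1 - ?w s) = sin (of_real pi * ?w s) / of_real pi"
        by (rule rGamma_reflection_complex)
      then have "rGamma (1 - ?w s) \<noteq> 0"
        using nz by auto
      then have "Gamma (1 - ?w s) = rGamma (?w s) / (rGamma (?w s) * rGamma (1 - ?w s))"
        using eq nz by (auto simp: Gamma_def field_simps)
      also have "\<dots> = rGamma (?w s) * (of_real pi / sin (of_real pi * ?w s))"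
        unfolding eq by simp
      finally show ?case
        by (auto simp: set_times_def algebra_simps)
    qed
  qed
qed

end

end

section \<open>The integrand of the I-function\<close>

lemma prod_in_set_prod:
  fixes f :: "'a \<Rightarrow> 'b::comm_monoid_mult"
  assumes "finite J" "\<And>j. j \<in> J \<Longrightarrow> f j \<in> V j"
  shows "(\<Prod>j\<in>J. f j) \<in> (\<Prod>j\<in>J. V j)"
  using assms by (induction J) auto

lemma inverse_power_values:
  assumes "u \<in> power_values w c"
  shows "inverse u \<in> power_values (inverse w) c"
proof (cases "w = 0")
  case False
  then obtain l where l: "u = exp (of_real c * l)" "exp l = w"
    using assms by (auto simp: power_values_def)
  then have "inverse u = exp (of_real c * (- l)) \<and> exp (- l) = inverse w"
    by (simp add: exp_minus)
  then have "\<exists>l'. inverse u = exp (of_real c * l') \<and> exp l' = inverse w"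
    by blast
  then show ?thesis
    using False by (simp add: power_values_def)
qed (use assms in \<open>simp add: power_values_def\<close>)

text \<open>An inclusion suffices, since the germ and the growth bound concern all values of the
  larger set. At a pole in the denominator the conventions agree: \<open>Gamma\<close>, its power,
  the inverse of that power and \<open>rGamma\<close> are all 0.\<close>

lemma I_integrand_values_subset:
  "I_integrand_values m n p q a \<alpha> A b \<beta> B s \<subseteq>
     (\<Prod>j=1..m. power_values (Gamma (b j - of_real (\<beta> j) * s)) (B j)) *
     (\<Prod>j=1..n. power_values (Gamma (1 - a j + of_real (\<alpha> j) * s)) (A j)) *
     (\<Prod>j=m+1..q. power_values (rGamma (1 - b j + of_real (\<beta> j) * s)) (B j)) *
     (\<Prod>j=n+1..p. power_values (rGamma (a j - of_real (\<alpha> j) * s)) (A j))"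
proof
  fix v assume "v \<in> I_integrand_values m n p q a \<alpha> A b \<beta> B s"
  then obtain U V W X where v: "v = ((\<Prod>j=1..m. U j) * (\<Prod>j=1..n. V j)) / ((\<Prod>j=m+1..q. W j) * (\<Prod>j=n+1..p. X j))"
    and U: "\<forall>j\<in>{1..m}. U j \<in> power_values (Gamma (b j - of_real (\<beta> j) * s)) (B j)"
    and V: "\<forall>j\<in>{1..n}. V j \<in> power_values (Gamma (1 - a j + of_real (\<alpha> j) * s)) (A j)"
    and W: "\<forall>j\<in>{m+1..q}. W j \<in> power_values (Gamma (1 - b j + of_real (\<beta> j) * s)) (B j)"
    and X: "\<forall>j\<in>{n+1..p}. X j \<in> power_values (Gamma (a j - of_real (\<alpha> j) * s)) (A j)"
    unfolding I_integrand_values_def by blast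
  have "v = (\<Prod>j=1..m. U j) * (\<Prod>j=1..n. V j) * (\<Prod>j=m+1..q. inverse (W j)) * (\<Prod>j=n+1..p. inverse (X j))"
    unfolding v using prod_inversef[of W "{m+1..q}"] prod_inversef[of X "{n+1..p}"]
    by (simp add: divide_inverse o_def)
  also have "\<dots> \<in> (\<Prod>j=1..m. power_values (Gamma (b j - of_real (\<beta> j) * s)) (B j)) *
     (\<Prod>j=1..n. power_values (Gamma (1 - a j + of_real (\<alpha> j) * s)) (A j)) *
     (\<Prod>j=m+1..q. power_values (rGamma (1 - b j + of_real (\<beta> j) * s)) (B j)) *
     (\<Prod>j=n+1..p. power_values (rGamma (a j - of_real (\<alpha> j) * s)) (A j))"
    unfolding rGamma_inverse_Gamma
    using U V W X by (intro set_times_intro prod_in_set_prod inverse_power_values) auto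
  finally show "v \<in> \<dots>" .
qed

lemma power_germ_power_values_Gamma:
  assumes "c + d * s0 \<notin> \<int>\<^sub>\<le>\<^sub>0" "0 < B"
  shows "power_germ s0 (\<lambda>s. power_values (Gamma (c + d * s)) B)"
proof -
  have "open ((\<lambda>s. c + d * s) -` (- \<int>\<^sub>\<le>\<^sub>0))"
    by (intro open_vimage open_Compl closed_nonpos_Ints continuous_intros)
  moreover have "s0 \<in> (\<lambda>s. c + d * s) -` (- \<int>\<^sub>\<le>\<^sub>0)"
    using assms(1) by simp
  ultimately obtain r where r: "0 < r" "ball s0 r \<subseteq> (\<lambda>s. c + d * s) -` (- \<int>\<^sub>\<le>\<^sub>0)"
    using open_contains_ball by metis
  show ?thesis
  proof (rule power_germ_power_values[OF _ r(1) _ assms(2)])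
    show "(\<lambda>s. Gamma (c + d * s)) holomorphic_on ball s0 r"
      using r(2) by (intro holomorphic_intros) auto
    show "\<exists>s\<in>ball s0 r. Gamma (c + d * s) \<noteq> 0"
      using r(1) assms(1) by (intro bexI[of _ s0]) (auto simp: Gamma_eq_zero_iff)
  qed
qed

lemma power_germ_power_values_rGamma:
  assumes "d \<noteq> 0" "0 < B"
  shows "power_germ s0 (\<lambda>s. power_values (rGamma (c + d * s)) B)"
proof (rule power_germ_power_values[OF _ zero_less_one _ assms(2)])
  show "(\<lambda>s. rGamma (c + d * s)) holomorphic_on ball s0 1"
    by (intro holomorphic_intros)
  show "\<exists>s\<in>ball s0 1. rGamma (c + d * s) \<noteq> 0"
  proof (cases "rGamma (c + d * s0) = 0")
    case True
    \<comment> \<open>The bound 1/2 keeps s0 + e in the unit disc, and |d e| \<le> 1/2 prevents two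
      integer arguments, as their difference would be a nonzero integer.\<close>
    define e where "e = min (1/2) (1 / (2 * norm d))"
    have e: "0 < e" "e < 1" "e * norm d \<le> 1/2"
      using assms(1) by (auto simp: e_def min_def field_simps)
    have "rGamma (c + d * (s0 + of_real e)) \<noteq> 0"
    proof
      assume "rGamma (c + d * (s0 + of_real e)) = 0"
      with True have "c + d * s0 \<in> \<int>" "c + d * (s0 + of_real e) \<in> \<int>"
        by (auto simp: rGamma_eq_zero_iff nonpos_Ints_Int)
      then have "c + d * (s0 + of_real e) - (c + d * s0) \<in> \<int>"
        by (rule Ints_diff[rotated])
      then obtain k where k: "d * of_real e = of_int k"
        by (auto simp: algebra_simps elim!: Ints_cases)
      then have "k \<noteq> 0"
        using e(1) assms(1) by auto
      then have "1 \<le> norm (d * of_real e)"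
        unfolding k by simp
      then show False
        using e by (simp add: norm_mult mult.commute)
    qed
    then show ?thesis
      using e by (intro bexI[of _ "s0 + of_real e"]) (auto simp: dist_norm)
  qed (auto intro: bexI[of _ s0])
qed

text \<open>For \<mu> < 0 the term x ln x beats every linear one. For \<mu> = 0 half of -\<kappa> is
  spent on \<epsilon>' and the other half remains as the rate \<epsilon>.\<close>

lemma eventually_le_linear_decay:
  fixes \<mu> \<kappa> :: real
  assumes "\<mu> < 0 \<or> \<mu> = 0 \<and> \<kappa> < 0"
  shows "\<exists>\<epsilon>>0. \<exists>\<epsilon>'>0. \<forall>\<^sub>F x in at_top. \<mu> * (x * ln x) + (\<kappa> + \<epsilon>') * x \<le> - \<epsilon> * x"
  using assms
proof
  assume "\<mu> < 0"
  then have "\<forall>\<^sub>F x in at_top. \<mu> * (x * ln x) + (\<kappa> + 1) * x \<le> - 1 * x"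
    by real_asymp
  then show ?thesis
    by (intro exI[of _ 1] conjI) auto
next
  assume "\<mu> = 0 \<and> \<kappa> < 0"
  then show ?thesis
    by (intro exI[of _ "- \<kappa> / 2"] conjI) auto
qed

lemma sum_split_at:
  fixes f :: "nat \<Rightarrow> real"
  assumes "m \<le> q"
  shows "(\<Sum>j=1..m. f j) + (\<Sum>j=m+1..q. f j) = (\<Sum>j=1..q. f j)"
  using sum.ub_add_nat[of 1 m f "q - m"] assms by simp

lemma ln_I_nu:
  assumes "\<And>j. j \<in> {1..p} \<Longrightarrow> \<alpha> j > 0" "\<And>j. j \<in> {1..q} \<Longrightarrow> \<beta> j > 0"
  shows "0 < I_nu p q \<alpha> A \<beta> B"
    and "ln (I_nu p q \<alpha> A \<beta> B) = (\<Sum>j=1..q. B j * \<beta> j * ln (\<beta> j)) - (\<Sum>j=1..p. A j * \<alpha> j * ln (\<alpha> j))"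
proof -
  have pos: "0 < (\<Prod>j=1..q. \<beta> j powr (B j * \<beta> j))" "0 < (\<Prod>j=1..p. \<alpha> j powr (A j * \<alpha> j))"
    using assms by (force intro!: prod_pos)+
  then show "0 < I_nu p q \<alpha> A \<beta> B"
    by (simp add: I_nu_def)
  have "ln (\<Prod>j=1..q. \<beta> j powr (B j * \<beta> j)) = (\<Sum>j=1..q. B j * \<beta> j * ln (\<beta> j))"
    using assms(2) by (subst ln_prod) (force simp: ln_powr intro!: sum.cong)+
  moreover have "ln (\<Prod>j=1..p. \<alpha> j powr (A j * \<alpha> j)) = (\<Sum>j=1..p. A j * \<alpha> j * ln (\<alpha> j))"
    using assms(1) by (subst ln_prod) (force simp: ln_powr intro!: sum.cong)+
  ultimately show "ln (I_nu p q \<alpha> A \<beta> B) = (\<Sum>j=1..q. B j * \<beta> j * ln (\<beta> j)) - (\<Sum>j=1..p. A j * \<alpha> j * ln (\<alpha> j))"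
    unfolding I_nu_def using pos by (simp only: ln_divide_pos)
qed

theorem theorem3:
  fixes m n p q :: nat
    and a b :: "nat \<Rightarrow> complex"
    and \<alpha> A \<beta> B :: "nat \<Rightarrow> real"
    and z :: complex and \<theta> :: real
    and \<gamma> :: "real \<Rightarrow> complex" and \<phi> :: "complex \<Rightarrow> complex"
  assumes "m \<le> q" and "n \<le> p"
    and "\<And>j. j \<in> {1..p} \<Longrightarrow> \<alpha> j > 0 \<and> A j > 0"
    and "\<And>j. j \<in> {1..q} \<Longrightarrow> \<beta> j > 0 \<and> B j > 0"
    and "left_singularities n a \<alpha> \<inter> right_singularities m b \<beta> = {}"
    and "left_loop \<gamma>"
    and "loop_separates \<gamma> (left_singularities n a \<alpha>) (right_singularities m b \<beta>)"
    and "I_integrand_branch_on (range \<gamma>) m n p q a \<alpha> A b \<beta> B \<phi>"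
    and "z \<noteq> 0" and "is_Arg z \<theta>"
    and "p \<ge> 1"
    and "I_mu p q \<alpha> A \<beta> B < 0 \<or>
         (I_mu p q \<alpha> A \<beta> B = 0 \<and> cmod z > I_nu p q \<alpha> A \<beta> B)"
  shows "\<exists>I. has_loop_integral
           (\<lambda>s. 1 / (2 * of_real pi * \<i>) * (\<phi> s * exp (s * (of_real (ln (cmod z)) + \<i> * of_real \<theta>)))) I \<gamma>"
proof -
  \<comment> \<open>Any argument \<theta> of z is allowed: it contributes the factor exp(-\<theta>
    Im s), bounded in the strip.\<close>
  define w where "w = complex_of_real (ln (cmod z)) + \<i> * of_real \<theta>"
  define E where "E s = 1 / (2 * of_real pi * \<i>) * exp (s * w)" for s
  define f where "f s = 1 / (2 * of_real pi * \<i>) * (\<phi> s * exp (s * w))" for s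
  define V where "V s = {E s} *
     ((\<Prod>j=1..m. power_values (Gamma (b j - of_real (\<beta> j) * s)) (B j)) *
     (\<Prod>j=1..n. power_values (Gamma (1 - a j + of_real (\<alpha> j) * s)) (A j)) *
     (\<Prod>j=m+1..q. power_values (rGamma (1 - b j + of_real (\<beta> j) * s)) (B j)) *
     (\<Prod>j=n+1..p. power_values (rGamma (a j - of_real (\<alpha> j) * s)) (A j)))" for s
  have \<alpha>: "0 < \<alpha> j" "0 < A j" if "j \<in> {1..p}" for j
    using assms(3) that by auto
  have \<beta>: "0 < \<beta> j" "0 < B j" if "j \<in> {1..q}" for j
    using assms(4) that by auto
  note loop = \<open>left_loop \<gamma>\<close>
  note cont_\<gamma> = left_loop_continuous[OF loop]
  \<comment> \<open>The distance \<delta> is used twice: it keeps the loop off the poles for the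
    germs, and it bounds the reflected Gamma factors.\<close>
  obtain \<delta> where \<delta>: "0 < \<delta>"
    "\<And>t w. w \<in> left_singularities n a \<alpha> \<union> right_singularities m b \<beta> \<Longrightarrow> \<delta> \<le> dist (\<gamma> t) w"
    using assms(7) unfolding loop_separates_def by blast
  have off: "\<gamma> t \<notin> left_singularities n a \<alpha>" "\<gamma> t \<notin> right_singularities m b \<beta>" for t
    using \<delta>(1) \<delta>(2)[of "\<gamma> t" t] by auto
  have cont_\<phi>: "continuous_on (range \<gamma>) \<phi>"
    and \<phi>: "\<And>s. s \<in> range \<gamma> \<Longrightarrow> \<phi> s \<in> I_integrand_values m n p q a \<alpha> A b \<beta> B s"
    using assms(8) by (auto simp: I_integrand_branch_on_def)
  have f_in: "f (\<gamma> t) \<in> V (\<gamma> t)" for t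
  proof -
    have "f (\<gamma> t) = E (\<gamma> t) * \<phi> (\<gamma> t)"
      by (simp add: f_def E_def)
    then show ?thesis
      unfolding V_def using subsetD[OF I_integrand_values_subset \<phi>[OF rangeI]]
      by (simp only: set_times_intro singletonI)
  qed
  have germ: "power_germ (\<gamma> t) V" for t
    unfolding V_def
  proof (intro power_germ_mult power_germ_prod)
    show "power_germ (\<gamma> t) (\<lambda>s. {E s})"
      unfolding E_def by (intro power_germ_holomorphic[of _ _ 1] holomorphic_intros) auto
  next
    fix j assume j: "j \<in> {1..m}"
    then show "power_germ (\<gamma> t) (\<lambda>s. power_values (Gamma (b j - of_real (\<beta> j) * s)) (B j))"
      using power_germ_power_values_Gamma[of "b j" "- of_real (\<beta> j)" "\<gamma> t" "B j"] off(2)[of t] \<beta>[of j] \<open>m \<le> q\<close>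
      by (auto simp: right_singularities_def)
  next
    fix j assume j: "j \<in> {1..n}"
    then show "power_germ (\<gamma> t) (\<lambda>s. power_values (Gamma (1 - a j + of_real (\<alpha> j) * s)) (A j))"
      using off(1)[of t] \<alpha>[of j] \<open>n \<le> p\<close>
      by (intro power_germ_power_values_Gamma) (auto simp: left_singularities_def)
  next
    fix j assume j: "j \<in> {m+1..q}"
    then show "power_germ (\<gamma> t) (\<lambda>s. power_values (rGamma (1 - b j + of_real (\<beta> j) * s)) (B j))"
      using \<beta>[of j] by (intro power_germ_power_values_rGamma) auto
  next
    fix j assume j: "j \<in> {n+1..p}"
    then show "power_germ (\<gamma> t) (\<lambda>s. power_values (rGamma (a j - of_real (\<alpha> j) * s)) (A j))"
      using power_germ_power_values_rGamma[of "- of_real (\<alpha> j)" "A j" "\<gamma> t" "a j"] \<alpha>[of j] by auto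
  qed
  have int: "(\<lambda>t. f (\<gamma> t) * vector_derivative \<gamma> (at t)) integrable_on {u..v}" for u v
  proof (rule integrable_power_germ_along_path[of \<gamma> V])
    show "continuous_on UNIV (\<lambda>t. f (\<gamma> t))"
      unfolding f_def
      by (intro continuous_intros continuous_on_compose2[OF cont_\<phi> cont_\<gamma>] cont_\<gamma>) auto
  qed (use germ cont_\<gamma> f_in left_loop_differentiable[OF loop] in auto)
  define \<mu> where "\<mu> = I_mu p q \<alpha> A \<beta> B"
  \<comment> \<open>The linear Stirling coefficients \<beta> (ln \<beta> - 1) and -\<alpha> (ln
    \<alpha> - 1), weighted by B and A, sum to ln \<nu> - \<mu>; the power of z adds -ln
    |z|.\<close>
  define \<kappa> where "\<kappa> = ln (I_nu p q \<alpha> A \<beta> B) - \<mu> - ln (cmod z)"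
  have \<nu>: "0 < I_nu p q \<alpha> A \<beta> B"
    "ln (I_nu p q \<alpha> A \<beta> B) = (\<Sum>j=1..q. B j * \<beta> j * ln (\<beta> j)) - (\<Sum>j=1..p. A j * \<alpha> j * ln (\<alpha> j))"
    using ln_I_nu[of p \<alpha> q \<beta> A B] \<alpha>(1) \<beta>(1) by auto
  obtain Y where Y: "\<And>t. \<bar>Im (\<gamma> t)\<bar> \<le> Y"
    using loop unfolding left_loop_def bounded_iff by auto
  have growth: "growth_le F V \<mu> \<kappa>"
    if F: "filterlim Re at_bot F" "\<forall>\<^sub>F s in F. s \<in> range \<gamma>" for F
  proof -
    have strip: "\<forall>\<^sub>F s in F. \<bar>Im s\<bar> \<le> Y"
      using F(2) by eventually_elim (use Y in auto)
    note F' = F(1) strip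
    have "growth_le F V
       (0 + ((\<Sum>j=1..m. B j * \<beta> j) + (\<Sum>j=1..n. A j * - \<alpha> j) + (\<Sum>j=m+1..q. B j * \<beta> j) + (\<Sum>j=n+1..p. A j * - \<alpha> j)))
       (- Re w + ((\<Sum>j=1..m. B j * (\<beta> j * (ln (\<beta> j) - 1))) + (\<Sum>j=1..n. A j * - (\<alpha> j * (ln (\<alpha> j) - 1))) +
          (\<Sum>j=m+1..q. B j * (\<beta> j * (ln (\<beta> j) - 1))) + (\<Sum>j=n+1..p. A j * - (\<alpha> j * (ln (\<alpha> j) - 1)))))"
      unfolding V_def E_def
    proof (intro growth_le_mult growth_le_prod[OF F'] growth_le_power_values growth_le_exp[OF F'])
      fix j assume "j \<in> {1..m}"
      then show "growth_le F (\<lambda>s. {Gamma (b j - of_real (\<beta> j) * s)}) (\<beta> j) (\<beta> j * (ln (\<beta> j) - 1))" "0 < B j"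
        using \<beta>[of j] \<open>m \<le> q\<close> growth_le_Gamma[OF F'] by auto
    next
      fix j assume j: "j \<in> {1..n}"
      have "\<forall>\<^sub>F s in F. \<forall>w. 1 - a j + of_real (\<alpha> j) * w \<in> \<int>\<^sub>\<le>\<^sub>0 \<longrightarrow> \<delta> \<le> dist s w"
        using F(2)
      proof eventually_elim
        case (elim s)
        have "w \<in> left_singularities n a \<alpha>" if "1 - a j + of_real (\<alpha> j) * w \<in> \<int>\<^sub>\<le>\<^sub>0" for w
          using j that by (auto simp: left_singularities_def)
        then show ?case
          using elim \<delta>(2) by blast
      qed
      then show "growth_le F (\<lambda>s. {Gamma (1 - a j + of_real (\<alpha> j) * s)}) (- \<alpha> j) (- (\<alpha> j * (ln (\<alpha> j) - 1)))" "0 < A j"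
        using \<alpha>[of j] j \<open>n \<le> p\<close> growth_le_Gamma_reflected[OF F' _ \<delta>(1)] by auto
    next
      fix j assume "j \<in> {m+1..q}"
      then show "growth_le F (\<lambda>s. {rGamma (1 - b j + of_real (\<beta> j) * s)}) (\<beta> j) (\<beta> j * (ln (\<beta> j) - 1))" "0 < B j"
        using \<beta>[of j] growth_le_rGamma_reflected[OF F'] by auto
    next
      fix j assume "j \<in> {n+1..p}"
      then show "growth_le F (\<lambda>s. {rGamma (a j - of_real (\<alpha> j) * s)}) (- \<alpha> j) (- (\<alpha> j * (ln (\<alpha> j) - 1)))" "0 < A j"
        using \<alpha>[of j] growth_le_rGamma[OF F'] by auto
    qed
    also have "0 + ((\<Sum>j=1..m. B j * \<beta> j) + (\<Sum>j=1..n. A j * - \<alpha> j) + (\<Sum>j=m+1..q. B j * \<beta> j) + (\<Sum>j=n+1..p. A j * - \<alpha> j)) = \<mu>"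
      unfolding \<mu>_def I_mu_def
      using sum_split_at[OF \<open>m \<le> q\<close>, of "\<lambda>j. B j * \<beta> j"] sum_split_at[OF \<open>n \<le> p\<close>, of "\<lambda>j. A j * \<alpha> j"]
      by (simp add: sum_negf)
    also have "- Re w + ((\<Sum>j=1..m. B j * (\<beta> j * (ln (\<beta> j) - 1))) + (\<Sum>j=1..n. A j * - (\<alpha> j * (ln (\<alpha> j) - 1))) +
          (\<Sum>j=m+1..q. B j * (\<beta> j * (ln (\<beta> j) - 1))) + (\<Sum>j=n+1..p. A j * - (\<alpha> j * (ln (\<alpha> j) - 1)))) = \<kappa>"
      unfolding \<kappa>_def \<mu>_def I_mu_def \<nu>(2)
      using sum_split_at[OF \<open>m \<le> q\<close>, of "\<lambda>j. B j * (\<beta> j * (ln (\<beta> j) - 1))"]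
        sum_split_at[OF \<open>n \<le> p\<close>, of "\<lambda>j. A j * (\<alpha> j * (ln (\<alpha> j) - 1))"]
      by (simp add: sum_negf right_diff_distrib sum_subtractf w_def mult.assoc)
    finally show ?thesis .
  qed
  \<comment> \<open>For \<mu> = 0 the coefficient \<kappa> is ln \<nu> - ln |z|, negative exactly
    when |z| > \<nu>.\<close>
  have "\<mu> < 0 \<or> \<mu> = 0 \<and> \<kappa> < 0"
    using assms(12) \<nu>(1) \<open>z \<noteq> 0\<close> by (auto simp: \<mu>_def \<kappa>_def)
  from eventually_le_linear_decay[OF this] obtain \<epsilon> \<epsilon>' where \<epsilon>: "0 < \<epsilon>" "0 < \<epsilon>'"
    "\<forall>\<^sub>F x in at_top. \<mu> * (x * ln x) + (\<kappa> + \<epsilon>') * x \<le> - \<epsilon> * x"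
    by blast
  have decay: "\<forall>\<^sub>F t in G. norm (f (\<gamma> t)) \<le> exp (\<epsilon> * Re (\<gamma> t))"
    if G: "filterlim (\<lambda>t. Re (\<gamma> t)) at_bot G" for G
  proof -
    \<comment> \<open>Growth was proved for any filter on the loop running to the left; the image
      filter under \<gamma> covers both ends.\<close>
    have "filterlim Re at_bot (filtermap \<gamma> G)"
      using G by (simp add: filterlim_filtermap)
    moreover have "\<forall>\<^sub>F s in filtermap \<gamma> G. s \<in> range \<gamma>"
      by (simp add: eventually_filtermap)
    ultimately have "growth_le (filtermap \<gamma> G) V \<mu> \<kappa>"
      by (rule growth)
    then have "\<forall>\<^sub>F t in G. \<forall>v\<in>V (\<gamma> t). norm v \<le>
        exp (\<mu> * (- Re (\<gamma> t) * ln (- Re (\<gamma> t))) + (\<kappa> + \<epsilon>') * (- Re (\<gamma> t)))"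
      using \<epsilon>(2) unfolding growth_le_def by (simp add: eventually_filtermap)
    moreover have "\<forall>\<^sub>F t in G. \<mu> * (- Re (\<gamma> t) * ln (- Re (\<gamma> t))) + (\<kappa> + \<epsilon>') * (- Re (\<gamma> t)) \<le> - \<epsilon> * (- Re (\<gamma> t))"
      using filterlim_compose[OF filterlim_uminus_at_top_at_bot G] \<epsilon>(3) unfolding filterlim_iff by blast
    ultimately show ?thesis
    proof eventually_elim
      case (elim t)
      have "norm (f (\<gamma> t)) \<le> exp (\<mu> * (- Re (\<gamma> t) * ln (- Re (\<gamma> t))) + (\<kappa> + \<epsilon>') * (- Re (\<gamma> t)))"
        using elim(1) f_in by blast
      also have "\<dots> \<le> exp (- \<epsilon> * (- Re (\<gamma> t)))"
        using elim(2) by (simp only: exp_le_cancel_iff)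
      finally show ?case
        by simp
    qed
  qed
  have "\<exists>I. has_loop_integral f I \<gamma>"
    using loop by (intro has_loop_integral_if_exponential_decay[OF loop int \<epsilon>(1)] decay) (auto simp: left_loop_def)
  then show ?thesis
    unfolding f_def w_def .
qed

end
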